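(* Let $k$ be an algebraically closed field of characteristic $p$ with $p=0$ or $p\ge5$, and let $\alpha_1,\alpha_2,\alpha_3,\alpha_4,\beta_1,\beta_2,\beta_3,\beta_4\in k$ be pairwise distinct. Put $\phi_1(x)=\prod_{i=1}^4(x-\alpha_i)$, $\phi_2(x)=\prod_{j=1}^4(x-\beta_j)$, and let $\tilde C\subset\mathbb{P}^2$ be the projective closure of the plane sextic curve $C: f(x,y)=0$, where $f=y^4-2(\phi_1+\phi_2)y^2+(\phi_1-\phi_2)^2$. Then $\tilde C$ has exactly $2$, $3$, or $4$ singularities, all of which are of multiplicity $2$. Moreover, it has $4$ double points generically, i.e. for all $(\alpha_1,\dots,\alpha_4,\beta_1,\dots,\beta_4)$ in a nonempty Zariski-open subset of the space of $8$-tuples of pairwise distinct elements of $k$.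
   Context: The projective closure is taken with respect to $(x,y)\mapsto(x:y:1)$; $f$ has total degree $6$, and $\tilde C$ is the zero locus in $\mathbb{P}^2$ of the degree-$6$ homogenization of $f$. A double point is a singular point of multiplicity $2$. The curve $C$ is the plane sextic model of the genus-$5$ non-hyperelliptic Howe curve (the desingularization of $C_1\times_{\mathbb{P}^1}C_2$, the fiber product over the $x$-line) associated with $C_1:y_1^2=\phi_1(x)$ and $C_2:y_2^2=\phi_2(x)$. *)

theory Defs
  imports
    "HOL-Analysis.Finite_Cartesian_Product"
    "HOL-Computational_Algebra.Polynomial"
    "HOL-Library.Poly_Mapping"
    "HOL-Library.Extended_Nat"
begin

type_synonym ('v, 'a) mpoly = "('v \<Rightarrow>\<^sub>0 nat) \<Rightarrow>\<^sub>0 'a"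

definition Var :: "'v \<Rightarrow> ('v, 'a::comm_ring_1) mpoly" where
  "Var v = Poly_Mapping.single (Poly_Mapping.single v 1) 1"

definition Const :: "'a \<Rightarrow> ('v, 'a::comm_ring_1) mpoly" where
  "Const a = Poly_Mapping.single 0 a"

text \<open>For a ring homomorphism \<open>h\<close>, this is the ring homomorphism which is \<open>h\<close> on
  coefficients and sends the variable \<open>v\<close> to \<open>\<sigma> v\<close>.\<close>

definition mpoly_subst ::
    "('a \<Rightarrow> 'b) \<Rightarrow> ('v \<Rightarrow> 'b) \<Rightarrow> ('v, 'a::comm_ring_1) mpoly \<Rightarrow> 'b::comm_ring_1" where
  "mpoly_subst h \<sigma> p =
     (\<Sum>m\<in>Poly_Mapping.keys p. h (Poly_Mapping.lookup p m) *
        (\<Prod>v\<in>Poly_Mapping.keys m. \<sigma> v ^ Poly_Mapping.lookup m v))"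

definition mpoly_eval :: "('v::finite, 'a::comm_ring_1) mpoly \<Rightarrow> 'a ^ 'v \<Rightarrow> 'a" where
  "mpoly_eval p c = mpoly_subst (\<lambda>a. a) (\<lambda>v. c $ v) p"

definition monom_degree :: "('v \<Rightarrow>\<^sub>0 nat) \<Rightarrow> nat" where
  "monom_degree m = (\<Sum>v\<in>Poly_Mapping.keys m. Poly_Mapping.lookup m v)"

definition total_degree :: "('v, 'a::comm_ring_1) mpoly \<Rightarrow> nat" where
  "total_degree p = Max (insert 0 (monom_degree ` Poly_Mapping.keys p))"

text \<open>The degree of the lowest nonzero homogeneous part; it is \<open>\<infinity>\<close> for the zero polynomial.\<close>

definition mpoly_order :: "('v, 'a::comm_ring_1) mpoly \<Rightarrow> enat" where
  "mpoly_order p = (INF m\<in>Poly_Mapping.keys p. enat (monom_degree m))"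

text \<open>In the monomials where the truncated subtraction matters, the coefficient is zero.\<close>

definition pdiff :: "'v \<Rightarrow> ('v, 'a::comm_ring_1) mpoly \<Rightarrow> ('v, 'a) mpoly" where
  "pdiff v p = (\<Sum>m\<in>Poly_Mapping.keys p.
     Poly_Mapping.single (m - Poly_Mapping.single v 1)
       (of_nat (Poly_Mapping.lookup m v) * Poly_Mapping.lookup p m))"

text \<open>\<open>U\<close> is relatively open in \<open>T\<close>, that is, the intersection of \<open>T\<close> with the complement of
  the common zero set of a set \<open>S\<close> of polynomials.\<close>

definition zariski_open_in :: "('a::comm_ring_1 ^ 'v) set \<Rightarrow> ('a ^ 'v) set \<Rightarrow> bool" where
  "zariski_open_in T U \<longleftrightarrow>
     (\<exists>S :: ('v::finite, 'a) mpoly set. U = T - {c. \<forall>p\<in>S. mpoly_eval p c = 0})"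

definition proj_rel :: "(('a::field ^ 3) \<times> ('a ^ 3)) set" where
  "proj_rel = {(v, w). v \<noteq> 0 \<and> w \<noteq> 0 \<and> (\<exists>c. c \<noteq> 0 \<and> w = c *s v)}"

definition proj_plane :: "('a::field ^ 3) set set" where
  "proj_plane = (UNIV - {0}) // proj_rel"

text \<open>The indices of the coordinates \<open>(x, y)\<close> are \<open>1, 2 :: 2\<close> and those of \<open>(x : y : z)\<close> are
  \<open>1, 2, 3 :: 3\<close>. These indices are distinct, although \<open>2 = (0::2)\<close> and \<open>3 = (0::3)\<close>. The
  affine plane is the chart \<open>z \<noteq> 0\<close> via \<open>(x, y) \<mapsto> (x : y : 1)\<close>.\<close>

definition homogenize :: "(2, 'a::comm_ring_1) mpoly \<Rightarrow> (3, 'a) mpoly" where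
  "homogenize f = (\<Sum>m\<in>Poly_Mapping.keys f. Const (Poly_Mapping.lookup f m) *
      Var 1 ^ Poly_Mapping.lookup m 1 * Var 2 ^ Poly_Mapping.lookup m 2 *
      Var 3 ^ (total_degree f - monom_degree m))"

text \<open>In the following, \<open>F\<close> is a nonzero homogeneous polynomial, so that the conditions do not
  depend on the representative \<open>v\<close> of the point \<open>P\<close>.\<close>

definition zero_locus :: "(3, 'a::field) mpoly \<Rightarrow> ('a ^ 3) set set" where
  "zero_locus F = {P \<in> proj_plane. \<forall>v\<in>P. mpoly_eval F v = 0}"

definition singular_points :: "(3, 'a::field) mpoly \<Rightarrow> ('a ^ 3) set set" where
  "singular_points F = {P \<in> zero_locus F. \<forall>v\<in>P. \<forall>i. mpoly_eval (pdiff i F) v = 0}"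

text \<open>The dehomogenization of \<open>F\<close> in the affine chart where the \<open>i\<close>-th coordinate is nonzero,
  translated such that the point represented by \<open>v\<close> becomes the origin.\<close>

definition local_equation :: "(3, 'a::field) mpoly \<Rightarrow> 3 \<Rightarrow> 'a ^ 3 \<Rightarrow> (3, 'a) mpoly" where
  "local_equation F i v =
     mpoly_subst Const (\<lambda>j. if j = i then 1 else Var j + Const (v $ j / v $ i)) F"

definition has_multiplicity :: "(3, 'a::field) mpoly \<Rightarrow> ('a ^ 3) set \<Rightarrow> nat \<Rightarrow> bool" where
  "has_multiplicity F P m \<longleftrightarrow>
     (\<forall>v\<in>P. \<forall>i. v $ i \<noteq> 0 \<longrightarrow> mpoly_order (local_equation F i v) = enat m)"

definition double_points :: "(3, 'a::field) mpoly \<Rightarrow> ('a ^ 3) set set" where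
  "double_points F = {P \<in> singular_points F. has_multiplicity F P 2}"

text \<open>A tuple \<open>c\<close> encodes \<open>\<alpha>\<^sub>i = c $ Inl i\<close> and \<open>\<beta>\<^sub>j = c $ Inr j\<close>.\<close>

definition distinct_tuples :: "('a ^ (4 + 4)) set" where
  "distinct_tuples = {c. inj (\<lambda>i. c $ i)}"

definition phi1 :: "'a::comm_ring_1 ^ (4 + 4) \<Rightarrow> (2, 'a) mpoly" where
  "phi1 c = (\<Prod>i\<in>UNIV. Var 1 - Const (c $ Inl i))"

definition phi2 :: "'a::comm_ring_1 ^ (4 + 4) \<Rightarrow> (2, 'a) mpoly" where
  "phi2 c = (\<Prod>j\<in>UNIV. Var 1 - Const (c $ Inr j))"

definition howe_sextic :: "'a::comm_ring_1 ^ (4 + 4) \<Rightarrow> (2, 'a) mpoly" where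
  "howe_sextic c =
     Var 2 ^ 4 - 2 * (phi1 c + phi2 c) * Var 2 ^ 2 + (phi1 c - phi2 c) ^ 2"

end

theory Submission
  imports Defs "HOL-Analysis.Cartesian_Space"
begin

text \<open>Write \<open>\<Phi>\<^sub>1, \<Phi>\<^sub>2\<close> for the quartic forms in \<open>x, z\<close> belonging to \<open>\<phi>\<^sub>1, \<phi>\<^sub>2\<close>. Both quartics
  are monic, so \<open>\<Phi>\<^sub>1 - \<Phi>\<^sub>2 = z D\<close> with a cubic form \<open>D\<close>, and the homogenization of \<open>f\<close> is
  \<open>F = y\<^sup>4 z\<^sup>2 - 2 (\<Phi>\<^sub>1 + \<Phi>\<^sub>2) y\<^sup>2 + D\<^sup>2\<close>. At a singular point with \<open>y z \<noteq> 0\<close> the equation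
  \<open>F\<^sub>y = 0\<close> gives \<open>y\<^sup>2 z\<^sup>2 = \<Phi>\<^sub>1 + \<Phi>\<^sub>2\<close>, then \<open>F = 0\<close> gives \<open>\<Phi>\<^sub>1 \<Phi>\<^sub>2 = 0\<close> and \<open>F\<^sub>x = 0\<close> gives a
  double root of \<open>\<Phi>\<^sub>1 \<Phi>\<^sub>2\<close>, which is impossible. Hence the singular points are \<open>(0 : 1 : 0)\<close> and
  the points \<open>(x : 0 : z)\<close> with \<open>D(x, z) = 0\<close>, of which there are one to three, and three when the
  discriminant of \<open>D\<close> does not vanish. The multiplicity is two because the local equation has
  the quadratic term \<open>z\<^sup>2\<close> at \<open>(0 : 1 : 0)\<close>, and \<open>- 2 (\<Phi>\<^sub>1 + \<Phi>\<^sub>2) y\<^sup>2\<close> at the other points.\<close>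

section \<open>Substitution and partial derivatives\<close>

text \<open>Inserting a fresh key amounts to adding a monomial. Substitution and partial derivatives
  are additive, so with this rule their product formulas need checking only on single
  monomials.\<close>

lemma mpoly_induct [case_names single add]:
  assumes "\<And>m a. P (Poly_Mapping.single m a)"
    and "\<And>p q. P p \<Longrightarrow> P q \<Longrightarrow> P (p + q)"
  shows "P (p :: ('v, 'a::comm_ring_1) mpoly)"
proof (induction p rule: update_induct)
  case const
  show ?case using assms(1)[of 0 0] by simp
next
  case (update f m a)
  have "Poly_Mapping.update m a f = f + Poly_Mapping.single m a"
    using update(1)
    by (intro poly_mapping_eqI) (auto simp: lookup_update lookup_add lookup_single in_keys_iff when_def)
  then show ?case using assms update by simp
qed

text \<open>A ring homomorphism on coefficients. Three instances are used: the identity for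
  evaluation, \<open>Const\<close> for dehomogenization and change of chart, and constant univariate
  polynomials for restriction to a line.\<close>

locale coeff_hom =
  fixes h :: "'a::comm_ring_1 \<Rightarrow> 'b::comm_ring_1"
  assumes zero: "h 0 = 0" and one: "h 1 = 1"
    and add: "h (a + b) = h a + h b" and mult: "h (a * b) = h a * h b"
begin

text \<open>Monomials outside the support contribute \<open>h 0 = 0\<close>. Hence two polynomials
  can be summed over one common index set, which makes additivity visible.\<close>

lemma subst_superset:
  assumes "finite A" "Poly_Mapping.keys p \<subseteq> A"
  shows "mpoly_subst h \<sigma> p = (\<Sum>m\<in>A. h (Poly_Mapping.lookup p m) *
           (\<Prod>v\<in>Poly_Mapping.keys m. \<sigma> v ^ Poly_Mapping.lookup m v))"
  unfolding mpoly_subst_def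
  using assms by (intro sum.mono_neutral_left) (auto simp: in_keys_iff zero)

lemma subst_add: "mpoly_subst h \<sigma> (p + q) = mpoly_subst h \<sigma> p + mpoly_subst h \<sigma> q"
proof -
  let ?A = "Poly_Mapping.keys p \<union> Poly_Mapping.keys q"
  have "Poly_Mapping.keys (p + q) \<subseteq> ?A" by (rule keys_add)
  then show ?thesis
    by (simp add: subst_superset[of ?A] lookup_add add algebra_simps sum.distrib)
qed

lemma subst_single: "mpoly_subst h \<sigma> (Poly_Mapping.single m a) =
    h a * (\<Prod>v\<in>Poly_Mapping.keys m. \<sigma> v ^ Poly_Mapping.lookup m v)"
  by (simp add: subst_superset[of "{m}"])

lemma monom_add: "(\<Prod>v\<in>Poly_Mapping.keys (m + n). \<sigma> v ^ Poly_Mapping.lookup (m + n) v) =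
    (\<Prod>v\<in>Poly_Mapping.keys m. \<sigma> v ^ Poly_Mapping.lookup m v) *
    (\<Prod>v\<in>Poly_Mapping.keys n. (\<sigma> v :: 'b) ^ Poly_Mapping.lookup n v)"
proof -
  let ?A = "Poly_Mapping.keys m \<union> Poly_Mapping.keys n"
  have E: "(\<Prod>v\<in>Poly_Mapping.keys k. \<sigma> v ^ Poly_Mapping.lookup k v) =
      (\<Prod>v\<in>?A. \<sigma> v ^ Poly_Mapping.lookup k v)" if "Poly_Mapping.keys k \<subseteq> ?A" for k
    using that by (intro prod.mono_neutral_left) (auto simp: in_keys_iff)
  show ?thesis
    by (subst (1 2 3) E) (auto simp: lookup_add power_add prod.distrib keys_add in_keys_iff)
qed

lemma subst_mult: "mpoly_subst h \<sigma> (p * q) = mpoly_subst h \<sigma> p * mpoly_subst h \<sigma> q"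
proof (induction p rule: mpoly_induct)
  case (single m a)
  show ?case
    by (induction q rule: mpoly_induct)
      (simp_all add: mult_single subst_single subst_add monom_add mult algebra_simps)
qed (simp add: algebra_simps subst_add)

lemma subst_Const: "mpoly_subst h \<sigma> (Const a) = h a"
  by (simp add: Const_def subst_single)

lemma subst_Var: "mpoly_subst h \<sigma> (Var v) = \<sigma> v"
  by (simp add: Var_def subst_single one)

lemma subst_1: "mpoly_subst h \<sigma> 1 = 1"
  using subst_single[of \<sigma> 0 1] by (simp add: one)

lemma subst_0: "mpoly_subst h \<sigma> 0 = 0"
  by (simp add: mpoly_subst_def)

lemma subst_uminus: "mpoly_subst h \<sigma> (- p) = - mpoly_subst h \<sigma> p"
  by (metis add_eq_0_iff ab_left_minus subst_0 subst_add)

lemma subst_diff: "mpoly_subst h \<sigma> (p - q) = mpoly_subst h \<sigma> p - mpoly_subst h \<sigma> q"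
  using subst_add[of \<sigma> p "- q"] by (simp add: subst_uminus)

lemma subst_numeral: "mpoly_subst h \<sigma> (numeral n) = numeral n"
  by (induction n) (simp_all only: numeral.simps subst_1 subst_add)

lemma subst_power: "mpoly_subst h \<sigma> (p ^ n) = mpoly_subst h \<sigma> p ^ n"
  by (induction n) (simp_all add: subst_1 subst_mult)

lemma subst_of_nat: "mpoly_subst h \<sigma> (of_nat n) = of_nat n"
  by (induction n) (simp_all add: subst_0 subst_1 subst_add)

lemma subst_prod: "mpoly_subst h \<sigma> (\<Prod>i\<in>A. f i) = (\<Prod>i\<in>A. mpoly_subst h \<sigma> (f i))"
  by (induction A rule: infinite_finite_induct) (simp_all add: subst_1 subst_mult)

lemma subst_sum: "mpoly_subst h \<sigma> (\<Sum>i\<in>A. f i) = (\<Sum>i\<in>A. mpoly_subst h \<sigma> (f i))"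
  by (induction A rule: infinite_finite_induct) (simp_all add: subst_0 subst_add)

lemmas subst_simps = subst_add subst_mult subst_Const subst_Var subst_1 subst_0 subst_uminus
  subst_diff subst_numeral subst_of_nat subst_power subst_prod

end

lemma Const_0: "Const 0 = 0" by (simp add: Const_def)
lemma Const_1: "Const 1 = 1" by (simp add: Const_def)
lemma Const_add: "Const (a + b) = Const a + Const b" by (simp add: Const_def single_add)
lemma Const_mult: "Const (a * b) = Const a * Const b" by (simp add: Const_def mult_single)

interpretation ident: coeff_hom "\<lambda>a::'a::comm_ring_1. a" by unfold_locales simp_all
interpretation Const: coeff_hom "Const :: 'a \<Rightarrow> ('v, 'a::comm_ring_1) mpoly"
  by unfold_locales (simp_all add: Const_0 Const_1 Const_add Const_mult)
interpretation pCons: coeff_hom "\<lambda>a::'a::comm_ring_1. [:a:]"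
  by unfold_locales (simp_all add: one_pCons)

lemma Const_uminus: "Const (- a) = - Const a" by (simp add: Const_def single_uminus)
lemma Const_diff: "Const (a - b) = Const a - Const b" by (simp add: Const_def single_diff)
lemma Const_power: "Const (a ^ n) = Const a ^ n"
  by (induction n) (simp_all add: Const_1 Const_mult)

lemmas eval_simps = mpoly_eval_def ident.subst_simps

section \<open>Formal partial derivatives\<close>

lemma pdiff_superset:
  assumes "finite A" "Poly_Mapping.keys p \<subseteq> A"
  shows "pdiff v p = (\<Sum>m\<in>A. Poly_Mapping.single (m - Poly_Mapping.single v 1)
       (of_nat (Poly_Mapping.lookup m v) * Poly_Mapping.lookup p m))"
  unfolding pdiff_def
  using assms by (intro sum.mono_neutral_left) (auto simp: in_keys_iff)

lemma pdiff_add: "pdiff v (p + q) = pdiff v p + pdiff v q"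
proof -
  let ?A = "Poly_Mapping.keys p \<union> Poly_Mapping.keys q"
  have "Poly_Mapping.keys (p + q) \<subseteq> ?A" by (rule keys_add)
  then show ?thesis
    by (simp add: pdiff_superset[of ?A] lookup_add algebra_simps single_add sum.distrib)
qed

lemma pdiff_single: "pdiff v (Poly_Mapping.single m a) =
    Poly_Mapping.single (m - Poly_Mapping.single v 1) (of_nat (Poly_Mapping.lookup m v) * a)"
  by (simp add: pdiff_superset[of "{m}"])

lemma pdiff_mult: "pdiff v (p * q) = pdiff v p * q + p * pdiff v q"
proof (induction p rule: mpoly_induct)
  case (single m a)
  show ?case
  proof (induction q rule: mpoly_induct)
    case (single n b)
    \<comment> \<open>Subtraction of exponents is truncated, so one exponent can be moved out only
      if \<open>v\<close> occurs in \<open>m\<close>. If it does not, the corresponding term of the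
      product rule has coefficient zero.\<close>
    have E: "m + n - Poly_Mapping.single v 1 = (m - Poly_Mapping.single v 1) + n"
      if "Poly_Mapping.lookup m v \<noteq> 0" for m n :: "'a \<Rightarrow>\<^sub>0 nat"
      using that by (intro poly_mapping_eqI) (auto simp: lookup_add lookup_minus lookup_single when_def)
    show ?case
      using E[of m n] E[of n m]
      by (cases "Poly_Mapping.lookup m v = 0"; cases "Poly_Mapping.lookup n v = 0")
        (simp_all add: pdiff_single mult_single lookup_add algebra_simps flip: single_add)
  qed (simp add: pdiff_add algebra_simps)
qed (simp add: pdiff_add algebra_simps)

lemma pdiff_0: "pdiff v 0 = 0" by (simp add: pdiff_def)

lemma pdiff_Const: "pdiff v (Const a) = 0"
  by (simp add: Const_def pdiff_single)

lemma pdiff_1: "pdiff v 1 = 0"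
  using pdiff_Const[of v 1] by (simp add: Const_1)

lemma pdiff_numeral: "pdiff v (numeral n) = 0"
  by (induction n) (simp_all only: numeral.simps pdiff_1 pdiff_add add_0_left)

lemma pdiff_Var: "pdiff v (Var w) = (if v = w then 1 else 0)"
  by (simp add: Var_def pdiff_single lookup_single)

lemma pdiff_uminus: "pdiff v (- p) = - pdiff v p"
  by (metis add_eq_0_iff ab_left_minus pdiff_0 pdiff_add)

lemma pdiff_diff: "pdiff v (p - q) = pdiff v p - pdiff v q"
  using pdiff_add[of v p "- q"] by (simp add: pdiff_uminus)

lemma pdiff_power: "pdiff v (p ^ n) = of_nat n * p ^ (n - 1) * pdiff v p"
proof (induction n)
  case (Suc n)
  \<comment> \<open>For \<open>n = 0\<close> the exponent \<open>n - 1\<close> is truncated to 0,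
    but the factor \<open>of_nat n\<close> makes both sides vanish.\<close>
  have "of_nat n * p ^ n = p * (of_nat n * p ^ (n - 1))"
    by (cases n) (simp_all add: mult.left_commute)
  then have "pdiff v (p ^ Suc n) = pdiff v p * p ^ n + of_nat n * p ^ n * pdiff v p"
    by (simp only: power_Suc pdiff_mult Suc.IH mult.assoc)
  then show ?case by (simp add: algebra_simps)
qed (simp add: pdiff_1)

lemmas pdiff_simps = pdiff_add pdiff_mult pdiff_Const pdiff_0 pdiff_1 pdiff_numeral pdiff_Var
  pdiff_uminus pdiff_diff pdiff_power

section \<open>Degree, order and homogeneity\<close>

lemma monom_degree_superset:
  assumes "finite A" "Poly_Mapping.keys m \<subseteq> A"
  shows "monom_degree m = (\<Sum>v\<in>A. Poly_Mapping.lookup m v)"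
  unfolding monom_degree_def
  using assms by (intro sum.mono_neutral_left) (auto simp: in_keys_iff)

lemma monom_degree_add: "monom_degree (m + n) = monom_degree m + monom_degree n"
proof -
  let ?A = "Poly_Mapping.keys m \<union> Poly_Mapping.keys n"
  have "Poly_Mapping.keys (m + n) \<subseteq> ?A" by (rule keys_add)
  then show ?thesis
    by (simp add: monom_degree_superset[of ?A] lookup_add sum.distrib)
qed

lemma monom_degree_0: "monom_degree 0 = 0"
  by (simp add: monom_degree_def)

lemma monom_degree_single: "monom_degree (Poly_Mapping.single v n) = n"
  by (simp add: monom_degree_def)

text \<open>The zero polynomial is homogeneous of every degree, so cancellation in sums needs no
  separate treatment.\<close>

definition homogeneous :: "nat \<Rightarrow> ('v, 'a::comm_ring_1) mpoly \<Rightarrow> bool" where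
  "homogeneous n p \<longleftrightarrow> (\<forall>m\<in>Poly_Mapping.keys p. monom_degree m = n)"

lemma homogeneous_add: "homogeneous n p \<Longrightarrow> homogeneous n q \<Longrightarrow> homogeneous n (p + q)"
  using keys_add[of p q] by (auto simp: homogeneous_def)

lemma homogeneous_uminus: "homogeneous n p \<Longrightarrow> homogeneous n (- p)"
  by (simp add: homogeneous_def)

lemma homogeneous_diff: "homogeneous n p \<Longrightarrow> homogeneous n q \<Longrightarrow> homogeneous n (p - q)"
  using homogeneous_add[of n p "- q"] by (simp add: homogeneous_uminus)

lemma homogeneous_mult: "homogeneous n p \<Longrightarrow> homogeneous k q \<Longrightarrow> homogeneous (n + k) (p * q)"
  using keys_mult[of p q] by (fastforce simp: homogeneous_def monom_degree_add)

lemma homogeneous_multI: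
  "homogeneous n p \<Longrightarrow> homogeneous k q \<Longrightarrow> n + k = d \<Longrightarrow> homogeneous d (p * q)"
  using homogeneous_mult by blast

lemma homogeneous_Const: "homogeneous 0 (Const a)"
  by (simp add: homogeneous_def Const_def monom_degree_0)

lemma homogeneous_Var: "homogeneous 1 (Var v)"
  by (simp add: homogeneous_def Var_def monom_degree_single)

lemma homogeneous_1: "homogeneous 0 1"
  using homogeneous_Const[of 1] by (simp add: Const_1)

lemma homogeneous_power: "homogeneous n p \<Longrightarrow> homogeneous (k * n) (p ^ k)"
  by (induction k) (simp_all add: homogeneous_1 homogeneous_mult)

section \<open>Lower and upper bounds for the order at the origin\<close>

lemma le_mpoly_order_iff:
  "enat n \<le> mpoly_order p \<longleftrightarrow> (\<forall>m\<in>Poly_Mapping.keys p. n \<le> monom_degree m)"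
  by (auto simp: mpoly_order_def le_INF_iff)

lemma le_mpoly_order_add:
  "enat n \<le> mpoly_order p \<Longrightarrow> enat n \<le> mpoly_order q \<Longrightarrow> enat n \<le> mpoly_order (p + q)"
  using keys_add[of p q] by (auto simp: le_mpoly_order_iff)

lemma le_mpoly_order_uminus: "enat n \<le> mpoly_order p \<Longrightarrow> enat n \<le> mpoly_order (- p)"
  by (simp add: le_mpoly_order_iff)

lemma le_mpoly_order_diff:
  "enat n \<le> mpoly_order p \<Longrightarrow> enat n \<le> mpoly_order q \<Longrightarrow> enat n \<le> mpoly_order (p - q)"
  using le_mpoly_order_add[of n p "- q"] by (simp add: le_mpoly_order_uminus)

lemma le_mpoly_order_mult:
  "enat n \<le> mpoly_order p \<Longrightarrow> enat k \<le> mpoly_order q \<Longrightarrow> enat (n + k) \<le> mpoly_order (p * q)"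
  using keys_mult[of p q] by (fastforce simp: le_mpoly_order_iff monom_degree_add intro: add_mono)

lemma le_mpoly_order_multL: "enat n \<le> mpoly_order p \<Longrightarrow> enat n \<le> mpoly_order (p * q)"
  using le_mpoly_order_mult[of n p 0 q] by (simp add: le_mpoly_order_iff)

lemma le_mpoly_order_power: "enat n \<le> mpoly_order p \<Longrightarrow> enat (k * n) \<le> mpoly_order (p ^ k)"
  by (induction k) (simp_all add: le_mpoly_order_iff[of 0] le_mpoly_order_mult zero_enat_def[symmetric])

text \<open>The only monomial of degree 0 is the constant one, and its coefficient is the value at
  the origin. Positive order is thereby tested by evaluation.\<close>

lemma one_le_mpoly_order_iff:
  fixes p :: "('v, 'a::comm_ring_1) mpoly"
  shows "enat 1 \<le> mpoly_order p \<longleftrightarrow> mpoly_subst (\<lambda>a. a) (\<lambda>_. 0) p = 0"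
proof -
  have D: "monom_degree m = 0 \<longleftrightarrow> m = 0" for m :: "'v \<Rightarrow>\<^sub>0 nat"
    by (auto simp: monom_degree_def in_keys_iff intro!: poly_mapping_eqI)
  have "mpoly_subst (\<lambda>a. a) (\<lambda>_. 0) p = (\<Sum>m\<in>Poly_Mapping.keys p. if m = 0 then Poly_Mapping.lookup p m else 0)"
    unfolding mpoly_subst_def
  proof (intro sum.cong refl)
    fix m :: "'v \<Rightarrow>\<^sub>0 nat"
    have "(\<Prod>v\<in>Poly_Mapping.keys m. (0::'a) ^ Poly_Mapping.lookup m v) = 0" if m: "m \<noteq> 0"
    proof (rule prod_zero)
      obtain v where "Poly_Mapping.lookup m v \<noteq> 0"
        using m poly_mapping_eqI[of m 0] by (metis lookup_zero)
      then show "\<exists>v\<in>Poly_Mapping.keys m. (0::'a) ^ Poly_Mapping.lookup m v = 0"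
        by (auto simp: in_keys_iff zero_power intro!: bexI[of _ v])
    qed simp
    then show "Poly_Mapping.lookup p m * (\<Prod>v\<in>Poly_Mapping.keys m. 0 ^ Poly_Mapping.lookup m v) =
        (if m = 0 then Poly_Mapping.lookup p m else 0)"
      by auto
  qed
  also have "\<dots> = Poly_Mapping.lookup p 0"
    by (simp add: in_keys_iff)
  finally show ?thesis
    by (auto simp: le_mpoly_order_iff D in_keys_iff Suc_le_eq simp flip: neq0_conv)
qed

text \<open>A monomial of degree d goes to a multiple of \<open>a ^ d\<close> as soon as each
  variable goes to a multiple of \<open>a\<close>. With \<open>a = X\<close> this restricts to a
  line through the origin and bounds the order from above.\<close>

lemma dvd_mpoly_subst_order:
  assumes "enat n \<le> mpoly_order p" "\<And>v. a dvd \<sigma> v"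
  shows "a ^ n dvd mpoly_subst h \<sigma> p"
  unfolding mpoly_subst_def
proof (intro dvd_sum dvd_mult)
  fix m assume m: "m \<in> Poly_Mapping.keys p"
  have "a ^ n dvd a ^ monom_degree m"
    using assms(1) m by (intro le_imp_power_dvd) (auto simp: le_mpoly_order_iff)
  also have "\<dots> = (\<Prod>v\<in>Poly_Mapping.keys m. a ^ Poly_Mapping.lookup m v)"
    by (simp add: monom_degree_def power_sum)
  also have "\<dots> dvd (\<Prod>v\<in>Poly_Mapping.keys m. \<sigma> v ^ Poly_Mapping.lookup m v)"
    by (intro prod_dvd_prod dvd_power_same assms)
  finally show "a ^ n dvd (\<Prod>v\<in>Poly_Mapping.keys m. \<sigma> v ^ Poly_Mapping.lookup m v)" .
qed

text \<open>Restriction to an affine line cannot raise the degree. This serves to bound the total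
  degree of f from below by looking at suitable lines.\<close>

lemma degree_mpoly_subst_le:
  fixes \<sigma> :: "'v \<Rightarrow> 'a::comm_ring_1 poly"
  assumes "\<And>v. degree (\<sigma> v) \<le> 1"
  shows "degree (mpoly_subst (\<lambda>a. [:a:]) \<sigma> p) \<le> total_degree p"
  unfolding mpoly_subst_def
proof (intro degree_sum_le)
  fix m assume m: "m \<in> Poly_Mapping.keys p"
  have "degree (\<Prod>v\<in>Poly_Mapping.keys m. \<sigma> v ^ Poly_Mapping.lookup m v)
      \<le> (\<Sum>v\<in>Poly_Mapping.keys m. degree (\<sigma> v ^ Poly_Mapping.lookup m v))"
    using degree_prod_sum_le[OF finite_keys] by (simp add: comp_def)
  also have "\<dots> \<le> monom_degree m"
    unfolding monom_degree_def
    by (intro sum_mono) (metis assms degree_power_le mult.commute mult.right_neutral mult_le_mono2 order.trans)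
  also have "\<dots> \<le> total_degree p"
    using m by (auto simp: total_degree_def)
  finally show "degree ([:Poly_Mapping.lookup p m:] *
      (\<Prod>v\<in>Poly_Mapping.keys m. \<sigma> v ^ Poly_Mapping.lookup m v)) \<le> total_degree p"
    by (metis (no_types, lifting) add_0 degree_mult_le degree_pCons_0 order.trans)
qed simp

section \<open>Homogenization\<close>

lemma mpoly_sum_monomials:
  "p = (\<Sum>m\<in>Poly_Mapping.keys p. Poly_Mapping.single m (Poly_Mapping.lookup p m))"
  by (rule poly_mapping_eqI) (auto simp: lookup_sum lookup_single when_def in_keys_iff)

lemma Var_power: "Var v ^ n = Poly_Mapping.single (Poly_Mapping.single v n) 1"
  by (induction n) (simp_all add: Var_def mult_single flip: single_add)

definition dehom :: "(3, 'a::comm_ring_1) mpoly \<Rightarrow> (2, 'a) mpoly" where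
  "dehom = mpoly_subst Const (\<lambda>v. if v = 1 then Var 1 else if v = 2 then Var 2 else 1)"

text \<open>With the target degree as a parameter the operation is additive in \<open>f\<close>; the
  degree in \<open>homogenize\<close> changes with the polynomial.\<close>

definition homogenize_to :: "nat \<Rightarrow> (2, 'a::comm_ring_1) mpoly \<Rightarrow> (3, 'a) mpoly" where
  "homogenize_to n f = (\<Sum>m\<in>Poly_Mapping.keys f. Const (Poly_Mapping.lookup f m) *
      Var 1 ^ Poly_Mapping.lookup m 1 * Var 2 ^ Poly_Mapping.lookup m 2 *
      Var 3 ^ (n - monom_degree m))"

lemma homogenize_to_superset:
  assumes "finite A" "Poly_Mapping.keys f \<subseteq> A"
  shows "homogenize_to n f = (\<Sum>m\<in>A. Const (Poly_Mapping.lookup f m) *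
      Var 1 ^ Poly_Mapping.lookup m 1 * Var 2 ^ Poly_Mapping.lookup m 2 *
      Var 3 ^ (n - monom_degree m))"
  unfolding homogenize_to_def
  using assms by (intro sum.mono_neutral_left) (auto simp: in_keys_iff Const_0)

lemma homogenize_to_add: "homogenize_to n (f + g) = homogenize_to n f + homogenize_to n g"
proof -
  let ?A = "Poly_Mapping.keys f \<union> Poly_Mapping.keys g"
  have "Poly_Mapping.keys (f + g) \<subseteq> ?A" by (rule keys_add)
  then show ?thesis
    by (simp add: homogenize_to_superset[of ?A] lookup_add Const_add algebra_simps sum.distrib)
qed

lemma homogenize_to_sum: "homogenize_to n (\<Sum>i\<in>A. f i) = (\<Sum>i\<in>A. homogenize_to n (f i))"
  by (induction A rule: infinite_finite_induct)
    (simp_all add: homogenize_to_add, simp_all add: homogenize_to_def)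

lemma monomial_3: "Poly_Mapping.single m a = Const a * Var 1 ^ Poly_Mapping.lookup m 1 *
    Var 2 ^ Poly_Mapping.lookup m 2 * Var (3::3) ^ Poly_Mapping.lookup m 3"
proof -
  have "m = Poly_Mapping.single 1 (Poly_Mapping.lookup m 1) +
      Poly_Mapping.single 2 (Poly_Mapping.lookup m 2) + Poly_Mapping.single 3 (Poly_Mapping.lookup m 3)"
  proof (rule poly_mapping_eqI)
    fix k :: 3
    show "Poly_Mapping.lookup m k = Poly_Mapping.lookup (Poly_Mapping.single 1 (Poly_Mapping.lookup m 1) +
      Poly_Mapping.single 2 (Poly_Mapping.lookup m 2) + Poly_Mapping.single 3 (Poly_Mapping.lookup m 3)) k"
      using exhaust_3[of k] by (auto simp: lookup_add lookup_single)
  qed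
  then show ?thesis
    by (simp add: Var_power Const_def mult_single)
qed

lemma monom_degree_3: "monom_degree (m :: 3 \<Rightarrow>\<^sub>0 nat) =
    Poly_Mapping.lookup m 1 + Poly_Mapping.lookup m 2 + Poly_Mapping.lookup m 3"
  using monom_degree_superset[of UNIV m] by (simp add: sum_3)

definition drop_last :: "(3 \<Rightarrow>\<^sub>0 nat) \<Rightarrow> (2 \<Rightarrow>\<^sub>0 nat)" where
  "drop_last m = Poly_Mapping.single 1 (Poly_Mapping.lookup m 1) +
    Poly_Mapping.single 2 (Poly_Mapping.lookup m 2)"

lemma monom_degree_drop_last:
  "monom_degree (drop_last m) = Poly_Mapping.lookup m 1 + Poly_Mapping.lookup m 2"
  by (simp add: drop_last_def monom_degree_add monom_degree_single)

lemma dehom_single: "dehom (Poly_Mapping.single m a) = Poly_Mapping.single (drop_last m) a"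
proof -
  have "dehom (Poly_Mapping.single m a) =
      Const a * Var 1 ^ Poly_Mapping.lookup m 1 * Var 2 ^ Poly_Mapping.lookup m 2"
    by (subst monomial_3) (simp add: dehom_def Const.subst_simps)
  then show ?thesis
    by (simp add: drop_last_def Var_power Const_def mult_single)
qed

lemma dehom_sum_monomials: "dehom p =
    (\<Sum>m\<in>Poly_Mapping.keys p. Poly_Mapping.single (drop_last m) (Poly_Mapping.lookup p m))"
  by (subst mpoly_sum_monomials) (simp add: dehom_def Const.subst_sum flip: dehom_single)

text \<open>Setting z = 1 loses no information on monomials of degree n: the exponent of z is n
  minus the other two exponents.\<close>

lemma homogenize_to_dehom:
  assumes "homogeneous n p"
  shows "homogenize_to n (dehom p) = p"
proof -
  have "homogenize_to n (Poly_Mapping.single (drop_last m) a) = Poly_Mapping.single m a"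
    if "monom_degree m = n" for m and a :: 'a
  proof -
    have "homogenize_to n (Poly_Mapping.single (drop_last m) a) = Const a *
        Var 1 ^ Poly_Mapping.lookup (drop_last m) 1 * Var 2 ^ Poly_Mapping.lookup (drop_last m) 2 *
        Var 3 ^ (n - monom_degree (drop_last m))"
      by (simp add: homogenize_to_superset[of "{drop_last m}"])
    also have "\<dots> = Poly_Mapping.single m a"
    proof -
      have "Poly_Mapping.lookup (drop_last m) 1 = Poly_Mapping.lookup m 1"
        "Poly_Mapping.lookup (drop_last m) 2 = Poly_Mapping.lookup m 2"
        by (simp_all add: drop_last_def lookup_add lookup_single)
      moreover have "n - monom_degree (drop_last m) = Poly_Mapping.lookup m 3"
        using that by (simp add: monom_degree_drop_last monom_degree_3)
      ultimately show ?thesis by (simp add: monomial_3[of m])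
    qed
    finally show ?thesis .
  qed
  then show ?thesis
    using assms mpoly_sum_monomials[of p]
    by (simp add: dehom_sum_monomials homogenize_to_sum homogeneous_def)
qed

lemma total_degree_dehom_le:
  assumes "homogeneous n p"
  shows "total_degree (dehom p) \<le> n"
proof -
  have "monom_degree m \<le> n" if m: "m \<in> Poly_Mapping.keys (dehom p)" for m
  proof -
    have "m \<in> drop_last ` Poly_Mapping.keys p"
      using m keys_sum[of "\<lambda>m. Poly_Mapping.single (drop_last m) (Poly_Mapping.lookup p m)" "Poly_Mapping.keys p"]
      by (auto simp: dehom_sum_monomials split: if_splits)
    then show ?thesis
      using assms by (auto simp: homogeneous_def monom_degree_3 monom_degree_drop_last)
  qed
  then show ?thesis by (auto simp: total_degree_def)
qed

text \<open>The second hypothesis says that the degree does not drop at z = 1. If z divided a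
  nonzero p, it would drop, and homogenization would not restore that factor.\<close>

lemma homogenize_dehom:
  assumes "homogeneous n p" "n \<le> total_degree (dehom p)"
  shows "homogenize (dehom p) = p"
proof -
  have "total_degree (dehom p) = n"
    using assms total_degree_dehom_le[of n p] by simp
  then have "homogenize (dehom p) = homogenize_to n (dehom p)"
    by (simp add: homogenize_def homogenize_to_def)
  then show ?thesis using homogenize_to_dehom assms by simp
qed

section \<open>The plane sextic\<close>

lemma prod_4: "prod f (UNIV :: 4 set) = f 1 * f 2 * f 3 * f 4"
  unfolding UNIV_4 by (simp add: ac_simps)

text \<open>This form and the next ones take arbitrary ring elements as arguments. The same
  expression then serves for polynomials, for their values and for their restrictions to lines, and
  substitution commutes with it.\<close>

definition quartic_form :: "(4 \<Rightarrow> 'a::comm_ring_1) \<Rightarrow> 'a \<Rightarrow> 'a \<Rightarrow> 'a" where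
  "quartic_form u x z = (\<Prod>i\<in>UNIV. x - u i * z)"

text \<open>Only meaningful for \<open>1 \<le> k \<le> 4\<close>.\<close>

definition esym :: "nat \<Rightarrow> (4 \<Rightarrow> 'a::comm_ring_1) \<Rightarrow> 'a" where
  "esym k u = (if k = 1 then u 1 + u 2 + u 3 + u 4
     else if k = 2 then u 1 * u 2 + u 1 * u 3 + u 1 * u 4 + u 2 * u 3 + u 2 * u 4 + u 3 * u 4
     else if k = 3 then u 1 * u 2 * u 3 + u 1 * u 2 * u 4 + u 1 * u 3 * u 4 + u 2 * u 3 * u 4
     else u 1 * u 2 * u 3 * u 4)"

text \<open>For \<open>k \<le> 3\<close>, this is the coefficient of \<open>x\<^sup>k\<close> in \<open>\<phi>\<^sub>1 - \<phi>\<^sub>2\<close>.\<close>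

definition dcoeff :: "nat \<Rightarrow> (4 + 4 \<Rightarrow> 'a::comm_ring_1) \<Rightarrow> 'a" where
  "dcoeff k u = (- 1) ^ k * (esym (4 - k) (u \<circ> Inl) - esym (4 - k) (u \<circ> Inr))"

definition cubic_form :: "(4 + 4 \<Rightarrow> 'a::comm_ring_1) \<Rightarrow> 'a \<Rightarrow> 'a \<Rightarrow> 'a" where
  "cubic_form u x z = dcoeff 3 u * x ^ 3 + dcoeff 2 u * x ^ 2 * z + dcoeff 1 u * x * z ^ 2 +
     dcoeff 0 u * z ^ 3"

text \<open>Both quartics are monic, so the terms in \<open>x ^ 4\<close> cancel and every remaining
  term contains z.\<close>

lemma cubic_form_eq:
  "z * cubic_form u x z = quartic_form (u \<circ> Inl) x z - quartic_form (u \<circ> Inr) x z"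
  by (simp add: cubic_form_def dcoeff_def esym_def quartic_form_def prod_4 algebra_simps
      power2_eq_square power3_eq_cube)

definition sextic_form :: "(4 + 4 \<Rightarrow> 'a::comm_ring_1) \<Rightarrow> 'a \<Rightarrow> 'a \<Rightarrow> 'a \<Rightarrow> 'a" where
  "sextic_form u x y z = y ^ 4 * z ^ 2 -
     2 * (quartic_form (u \<circ> Inl) x z + quartic_form (u \<circ> Inr) x z) * y ^ 2 + cubic_form u x z ^ 2"

context coeff_hom
begin

lemma subst_quartic_form: "mpoly_subst h \<sigma> (quartic_form u p q) =
    quartic_form (mpoly_subst h \<sigma> \<circ> u) (mpoly_subst h \<sigma> p) (mpoly_subst h \<sigma> q)"
  by (simp add: quartic_form_def subst_simps)

lemma subst_dcoeff: "mpoly_subst h \<sigma> (dcoeff k u) = dcoeff k (mpoly_subst h \<sigma> \<circ> u)"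
  by (simp add: dcoeff_def esym_def subst_simps)

lemma subst_cubic_form: "mpoly_subst h \<sigma> (cubic_form u p q) =
    cubic_form (mpoly_subst h \<sigma> \<circ> u) (mpoly_subst h \<sigma> p) (mpoly_subst h \<sigma> q)"
  by (simp add: cubic_form_def subst_simps subst_dcoeff)

lemma subst_sextic_form: "mpoly_subst h \<sigma> (sextic_form u p q r) =
    sextic_form (mpoly_subst h \<sigma> \<circ> u) (mpoly_subst h \<sigma> p) (mpoly_subst h \<sigma> q) (mpoly_subst h \<sigma> r)"
  by (simp add: sextic_form_def subst_simps subst_quartic_form subst_cubic_form comp_assoc)

lemma subst_comp_Const: "mpoly_subst h \<sigma> \<circ> (\<lambda>i. Const (a i)) = (\<lambda>i. h (a i))"
  by (simp add: fun_eq_iff subst_Const)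

end

lemma Const_dcoeff: "Const (dcoeff k u) = dcoeff k (\<lambda>i. Const (u i))"
  by (simp add: dcoeff_def esym_def Const_1 Const_add Const_mult Const_diff Const_power Const_uminus)

definition plane_sextic :: "'a::comm_ring_1 ^ (4 + 4) \<Rightarrow> (3, 'a) mpoly" where
  "plane_sextic c = sextic_form (\<lambda>i. Const (c $ i)) (Var 1) (Var 2) (Var 3)"

lemma dehom_plane_sextic: "dehom (plane_sextic c) = howe_sextic c"
proof -
  let ?u = "\<lambda>i. Const (c $ i) :: (2, 'a) mpoly"
  have "dehom (plane_sextic c) = sextic_form ?u (Var 1) (Var 2) 1"
    by (simp add: dehom_def plane_sextic_def Const.subst_sextic_form Const.subst_comp_Const
        Const.subst_Var)
  moreover have "quartic_form (?u \<circ> Inl) (Var 1) 1 = phi1 c" "quartic_form (?u \<circ> Inr) (Var 1) 1 = phi2 c"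
    by (simp_all add: quartic_form_def phi1_def phi2_def)
  \<comment> \<open>At z = 1 the factor z in \<open>cubic_form_eq\<close> disappears.\<close>
  moreover have "cubic_form ?u (Var 1) 1 = phi1 c - phi2 c"
    using cubic_form_eq[of 1 ?u "Var 1"] calculation by simp
  ultimately show ?thesis
    by (simp add: sextic_form_def howe_sextic_def)
qed

lemma homogeneous_Const_mult: "homogeneous n p \<Longrightarrow> homogeneous n (Const a * p)"
  using homogeneous_mult[OF homogeneous_Const, of n p a] by simp

lemma homogeneous_quartic_form:
  "homogeneous 4 (quartic_form (\<lambda>i. Const (a i)) (Var v) (Var w))"
proof -
  have L: "homogeneous 1 (Var v - Const (a i) * Var w)" for i
    by (intro homogeneous_diff homogeneous_Const_mult homogeneous_Var)
  have "homogeneous (1 + 1 + 1 + 1) (quartic_form (\<lambda>i. Const (a i)) (Var v) (Var w))"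
    unfolding quartic_form_def prod_4 by (intro homogeneous_mult L)
  then show ?thesis by (simp add: numeral_eq_Suc)
qed

lemma homogeneous_cubic_form:
  "homogeneous 3 (cubic_form (\<lambda>i. Const (a i)) (Var v) (Var w))"
proof -
  have V: "homogeneous k (Var v ^ k)" for k v
    using homogeneous_power[OF homogeneous_Var, of k v] by simp
  have "homogeneous 3 (Const d * Var v ^ 3)" for d v
    by (intro homogeneous_Const_mult V)
  moreover have "homogeneous 3 (Const d * Var v ^ 2 * Var w)" for d
    by (rule homogeneous_multI[OF homogeneous_Const_mult[OF V] homogeneous_Var]) simp
  moreover have "homogeneous 3 (Const d * Var v * Var w ^ 2)" for d
    by (rule homogeneous_multI[OF homogeneous_Const_mult[OF homogeneous_Var] V]) simp
  ultimately show ?thesis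
    unfolding cubic_form_def by (auto intro!: homogeneous_add simp flip: Const_dcoeff)
qed

lemma homogeneous_plane_sextic: "homogeneous 6 (plane_sextic c)"
proof -
  let ?Q = "quartic_form (\<lambda>i. Const (c $ Inl i)) (Var 1) (Var 3)
    + quartic_form (\<lambda>i. Const (c $ Inr i)) (Var 1) (Var 3) :: (3, 'a) mpoly"
  let ?D = "cubic_form (\<lambda>i. Const (c $ i)) (Var 1) (Var 3) :: (3, 'a) mpoly"
  have V: "homogeneous k (Var v ^ k)" for k v
    using homogeneous_power[OF homogeneous_Var, of k v] by simp
  have 1: "homogeneous (4 + 2) (Var 2 ^ 4 * Var 3 ^ 2 :: (3, 'a) mpoly)"
    by (intro homogeneous_mult V)
  have 2: "homogeneous (4 + 2) ((?Q + ?Q) * Var 2 ^ 2)"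
    by (intro homogeneous_mult homogeneous_add homogeneous_quartic_form V)
  have 3: "homogeneous (2 * 3) (?D ^ 2)"
    by (intro homogeneous_power homogeneous_cubic_form)
  have "plane_sextic c = Var 2 ^ 4 * Var 3 ^ 2 - (?Q + ?Q) * Var 2 ^ 2 + ?D ^ 2"
    by (simp add: plane_sextic_def sextic_form_def comp_def algebra_simps)
  with 1 2 3 show ?thesis
    by (simp add: homogeneous_add homogeneous_diff)
qed

text \<open>If the degree were at most 5, the restriction of f to the line y = 0 would show that the
  square of \<phi>1 - \<phi>2 contributes nothing in degree 6. On the line y = x the coefficient of
  degree 6 is then -4, which is nonzero.\<close>

lemma total_degree_howe_sextic:
  fixes c :: "'a::idom ^ (4 + 4)"
  assumes "(2::'a) \<noteq> 0"
  shows "6 \<le> total_degree (howe_sextic c)"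
proof (rule ccontr)
  assume "\<not> ?thesis"
  then have deg: "degree (mpoly_subst (\<lambda>a. [:a:]) \<sigma> (howe_sextic c)) \<le> 5"
    if "\<And>v. degree (\<sigma> v) \<le> 1" for \<sigma>
    using degree_mpoly_subst_le[of \<sigma> "howe_sextic c"] that by fastforce
  \<comment> \<open>The line y = t x through the origin, used for t = 0 and t = 1.\<close>
  let ?\<sigma> = "\<lambda>t v. if v = (1::2) then [:0, 1:] else [:0, t::'a:]"
  define P1 where "P1 = (\<Prod>i\<in>UNIV. [:- (c $ Inl i), 1:])"
  define P2 where "P2 = (\<Prod>i\<in>UNIV. [:- (c $ Inr i), 1:])"
  have E: "mpoly_subst (\<lambda>a. [:a:]) (?\<sigma> t) (howe_sextic c) =
      [:0, t:] ^ 4 - 2 * (P1 + P2) * [:0, t:] ^ 2 + (P1 - P2) ^ 2" for t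
    by (simp add: howe_sextic_def pCons.subst_simps phi1_def phi2_def P1_def P2_def)
  have "degree ((P1 - P2) ^ 2) \<le> 5"
    using deg[of "?\<sigma> 0"] E[of 0] by simp
  \<comment> \<open>The degree of a square is even, so a bound by 5 is a bound by 4.\<close>
  then have "degree (P1 - P2) \<le> 2"
    by (cases "P1 - P2 = 0") (simp_all add: power2_eq_square degree_mult_eq)
  then have "degree ((P1 - P2) ^ 2) < 6"
    using degree_power_le[of "P1 - P2" 2] by linarith
  then have "coeff ((P1 - P2) ^ 2) 6 = 0"
    by (rule coeff_eq_0)
  moreover have "degree ([:0, 1:] ^ 4 - 2 * (P1 + P2) * [:0, 1:] ^ 2 + (P1 - P2) ^ 2) < 6"
    using deg[of "?\<sigma> 1"] E[of 1] by simp
  then have "coeff ([:0, 1:] ^ 4 - 2 * (P1 + P2) * [:0, 1:] ^ 2 + (P1 - P2) ^ 2) 6 = 0"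
    by (rule coeff_eq_0)
  moreover have "coeff ([:0, 1:] ^ 4 :: 'a poly) 6 = 0"
    by (intro coeff_eq_0) (simp add: degree_power_eq)
  ultimately have "coeff (2 * (P1 + P2) * [:0, 1:] ^ 2) 6 = 0"
    by simp
  moreover have "coeff (2 * (P1 + P2) * [:0, 1:] ^ 2) 6 = 2 * (coeff P1 4 + coeff P2 4)"
    by (simp add: numeral_poly power2_eq_square numeral_eq_Suc algebra_simps)
  moreover have "coeff P1 4 = 1" "coeff P2 4 = 1"
    by (simp_all add: P1_def P2_def prod_4 numeral_eq_Suc)
  ultimately have "(2 :: 'a) * (1 + 1) = 0" by argo
  with assms show False by (simp only: mult_eq_0_iff one_add_one simp_thms)
qed

lemma homogenize_howe_sextic:
  fixes c :: "'a::idom ^ (4 + 4)"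
  assumes "(2::'a) \<noteq> 0"
  shows "homogenize (howe_sextic c) = plane_sextic c"
  using homogenize_dehom[OF homogeneous_plane_sextic, of c] total_degree_howe_sextic[OF assms, of c]
  by (simp add: dehom_plane_sextic)

section \<open>Singular points and their multiplicity\<close>

abbreviation Q1 :: "'a::comm_ring_1 ^ (4 + 4) \<Rightarrow> 'a ^ 3 \<Rightarrow> 'a" where
  "Q1 c v \<equiv> quartic_form (\<lambda>i. c $ Inl i) (v $ 1) (v $ 3)"

abbreviation Q2 :: "'a::comm_ring_1 ^ (4 + 4) \<Rightarrow> 'a ^ 3 \<Rightarrow> 'a" where
  "Q2 c v \<equiv> quartic_form (\<lambda>i. c $ Inr i) (v $ 1) (v $ 3)"

abbreviation D :: "'a::comm_ring_1 ^ (4 + 4) \<Rightarrow> 'a ^ 3 \<Rightarrow> 'a" where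
  "D c v \<equiv> cubic_form (\<lambda>i. c $ i) (v $ 1) (v $ 3)"

lemma D_eq: "v $ 3 * D c v = Q1 c v - Q2 c v"
  using cubic_form_eq[of "v $ 3" "\<lambda>i. c $ i" "v $ 1"] by (simp add: comp_def)

lemma quartic_form_eq_0_iff:
  fixes z :: "'a::idom"
  shows "quartic_form a x z = 0 \<longleftrightarrow> (\<exists>i. x = a i * z)"
  by (simp add: quartic_form_def)

text \<open>A common zero gives x = \<alpha> z = \<beta> z for some root \<alpha> of \<phi>1 and
  some root \<beta> of \<phi>2. Since \<alpha> and \<beta> differ, z = 0 and then x = 0.\<close>

lemma Q1_Q2_common_zero:
  fixes c :: "'a::field ^ (4 + 4)"
  assumes "c \<in> distinct_tuples" "Q1 c v = 0" "Q2 c v = 0"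
  shows "v $ 1 = 0 \<and> v $ 3 = 0"
proof -
  obtain i where "v $ 1 = c $ Inl i * v $ 3"
    using assms(2) by (auto simp: quartic_form_eq_0_iff)
  moreover obtain j where "v $ 1 = c $ Inr j * v $ 3"
    using assms(3) by (auto simp: quartic_form_eq_0_iff)
  moreover have "c $ Inl i \<noteq> c $ Inr j"
    using assms(1) by (auto simp: distinct_tuples_def dest: injD)
  ultimately show ?thesis by auto
qed

text \<open>The roots are simple: at the root \<open>a i\<close> the product rule leaves only the
  term without the i-th factor, a product of nonzero factors \<open>(a i - a j) * z\<close>.\<close>

lemma eval_pdiff_quartic_form:
  fixes a :: "4 \<Rightarrow> 'a::field" and v :: "'a ^ 3"
  assumes "inj a" "v $ 3 \<noteq> 0" "quartic_form a (v $ 1) (v $ 3) = 0"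
  shows "mpoly_eval (pdiff 1 (quartic_form (\<lambda>i. Const (a i)) (Var 1) (Var 3))) v \<noteq> 0"
proof -
  have "a i = a j \<longleftrightarrow> i = j" for i j
    using assms(1) by (simp add: inj_eq)
  moreover obtain i where "v $ 1 = a i * v $ 3"
    using assms(3) by (auto simp: quartic_form_eq_0_iff)
  ultimately show ?thesis
    using assms(2) exhaust_4[of i]
    by (auto simp: quartic_form_def prod_4 pdiff_simps eval_simps)
qed

text \<open>The first alternative is the point (0 : 1 : 0), the second a zero of D on the axis y =
  0. The zero vector is included, so the criterion below holds for all vectors.\<close>

definition sing_cond :: "'a::field ^ (4 + 4) \<Rightarrow> 'a ^ 3 \<Rightarrow> bool" where
  "sing_cond c v \<longleftrightarrow> v $ 1 = 0 \<and> v $ 3 = 0 \<or> v $ 2 = 0 \<and> D c v = 0"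

text \<open>The case y z \<noteq> 0 as pure algebra: A, B, C stand for the values of the two quartic
  forms and of D, and primes for derivatives in x. The equations force both A B and its derivative
  A' B + A B' to vanish.\<close>

lemma no_other_singularity:
  fixes x y z A B A' B' C C' :: "'a::field"
  assumes "y \<noteq> 0" "z \<noteq> 0" "(2::'a) \<noteq> 0" "z * C = A - B" "z * C' = A' - B'"
    and F: "y ^ 4 * z ^ 2 - 2 * (A + B) * y ^ 2 + C ^ 2 = 0"
    and Fx: "C * C' = (A' + B') * y ^ 2"
    and Fy: "y ^ 2 * z ^ 2 = A + B"
    and "A = 0 \<Longrightarrow> B \<noteq> 0 \<and> A' \<noteq> 0" "B = 0 \<Longrightarrow> A \<noteq> 0 \<and> B' \<noteq> 0"
  shows False
proof -
  \<comment> \<open>4 A B is a difference of squares, with A - B = z C and A + B =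
    \<open>y ^ 2 * z ^ 2\<close>. After this substitution it is a multiple of F.\<close>
  have "2 * 2 * (A * B) = (A + B) ^ 2 - (z * C) ^ 2"
    unfolding assms(4) by (simp add: power2_eq_square algebra_simps)
  also have "\<dots> = - (z ^ 2 * (y ^ 4 * z ^ 2 - 2 * (A + B) * y ^ 2 + C ^ 2))"
    unfolding Fy[symmetric] by (simp add: power2_eq_square power4_eq_xxxx algebra_simps)
  finally have "2 * (2 * (A * B)) = 0" using F by (simp add: mult.assoc)
  then have "A * B = 0" using assms(3) by (simp only: mult_eq_0_iff simp_thms)
  \<comment> \<open>The polarized form of the same identity, now leading to a multiple of the
    x-derivative of F.\<close>
  have "2 * (A' * B + A * B') = (A' + B') * (A + B) - (z * C) * (z * C')"
    unfolding assms(4,5) by (simp add: algebra_simps)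
  also have "\<dots> = z ^ 2 * ((A' + B') * y ^ 2 - C * C')"
    unfolding Fy[symmetric] by (simp add: power2_eq_square algebra_simps)
  finally have "2 * (A' * B + A * B') = 0" using Fx by (simp only: diff_self mult_zero_right)
  then have "A' * B + A * B' = 0" using assms(3) by (simp only: mult_eq_0_iff simp_thms)
  with \<open>A * B = 0\<close> assms(9,10) show False by auto
qed

lemma singular_iff:
  fixes c :: "'a::field ^ (4 + 4)" and v :: "'a ^ 3"
  assumes two: "(2::'a) \<noteq> 0" and c: "c \<in> distinct_tuples"
  shows "mpoly_eval (plane_sextic c) v = 0 \<and> (\<forall>i. mpoly_eval (pdiff i (plane_sextic c)) v = 0)
    \<longleftrightarrow> sing_cond c v"
proof -
  define x y z where "x = v $ 1" and "y = v $ 2" and "z = v $ 3"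
  let ?a = "\<lambda>i. c $ Inl i" and ?b = "\<lambda>i. c $ Inr i"
  let ?A = "quartic_form (\<lambda>i. Const (?a i)) (Var 1) (Var 3) :: (3, 'a) mpoly"
  let ?B = "quartic_form (\<lambda>i. Const (?b i)) (Var 1) (Var 3) :: (3, 'a) mpoly"
  let ?C = "cubic_form (\<lambda>i. Const (c $ i)) (Var 1) (Var 3) :: (3, 'a) mpoly"
  have F: "plane_sextic c = Var 2 ^ 4 * Var 3 ^ 2 - 2 * (?A + ?B) * Var 2 ^ 2 + ?C ^ 2"
    by (simp add: plane_sextic_def sextic_form_def comp_def)
  have ev: "mpoly_eval ?A v = Q1 c v" "mpoly_eval ?B v = Q2 c v" "mpoly_eval ?C v = D c v"
    by (simp_all add: mpoly_eval_def ident.subst_quartic_form ident.subst_cubic_form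
        ident.subst_comp_Const ident.subst_Var)
  have pd2: "pdiff 2 ?A = 0" "pdiff 2 ?B = 0" "pdiff 2 ?C = 0"
    by (simp_all add: quartic_form_def prod_4 cubic_form_def pdiff_simps flip: Const_dcoeff)
  define A' where "A' i = mpoly_eval (pdiff i ?A) v" for i
  define B' where "B' i = mpoly_eval (pdiff i ?B) v" for i
  define C' where "C' i = mpoly_eval (pdiff i ?C) v" for i
  note ev' = ev[unfolded mpoly_eval_def] A'_def[unfolded mpoly_eval_def, symmetric]
    B'_def[unfolded mpoly_eval_def, symmetric] C'_def[unfolded mpoly_eval_def, symmetric]
  have eF: "mpoly_eval (plane_sextic c) v =
      y ^ 4 * z ^ 2 - 2 * (Q1 c v + Q2 c v) * y ^ 2 + D c v ^ 2"
    by (simp add: F eval_simps ev' y_def z_def)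
  have eF1: "mpoly_eval (pdiff 1 (plane_sextic c)) v = 2 * (D c v * C' 1 - (A' 1 + B' 1) * y ^ 2)"
    by (simp add: F pdiff_simps eval_simps ev' y_def z_def algebra_simps)
  have eF2: "mpoly_eval (pdiff 2 (plane_sextic c)) v =
      2 * 2 * y * (y ^ 2 * z ^ 2 - (Q1 c v + Q2 c v))"
    by (simp add: F pdiff_simps pd2 eval_simps ev' y_def z_def algebra_simps power2_eq_square
        power3_eq_cube)
  have eF3: "mpoly_eval (pdiff 3 (plane_sextic c)) v =
      2 * (y ^ 4 * z - (A' 3 + B' 3) * y ^ 2 + D c v * C' 3)"
    by (simp add: F pdiff_simps eval_simps ev' y_def z_def algebra_simps)
  \<comment> \<open>Differentiating this identity in x, with z treated as a constant, relates the
    derivative of D to those of the two quartics.\<close>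
  have "Var 3 * ?C = ?A - ?B"
    using cubic_form_eq[of "Var 3" "\<lambda>i. Const (c $ i)" "Var 1 :: (3, 'a) mpoly"] by (simp add: comp_def)
  then have "mpoly_eval (pdiff 1 (Var 3 * ?C)) v = mpoly_eval (pdiff 1 (?A - ?B)) v"
    by simp
  then have zC': "z * C' 1 = A' 1 - B' 1"
    by (simp add: pdiff_simps eval_simps ev' z_def)
  have inj: "inj ?a" "inj ?b"
    using c by (auto simp: distinct_tuples_def inj_def)
  have "(2::'a) * 2 \<noteq> 0" using two by (simp only: mult_eq_0_iff simp_thms)
  then have four: "(4::'a) \<noteq> 0" by simp
  show ?thesis
  proof
    assume L: "mpoly_eval (plane_sextic c) v = 0 \<and>
      (\<forall>i. mpoly_eval (pdiff i (plane_sextic c)) v = 0)"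
    show "sing_cond c v"
    proof (cases "y = 0")
      case True
      then show ?thesis using L eF by (simp add: sing_cond_def y_def)
    next
      case False
      then have Fy: "y ^ 2 * z ^ 2 = Q1 c v + Q2 c v"
        using L eF2 four by auto
      have "z = 0"
      proof (rule ccontr)
        assume z: "z \<noteq> 0"
        have "Q1 c v = 0 \<Longrightarrow> Q2 c v \<noteq> 0 \<and> A' 1 \<noteq> 0" "Q2 c v = 0 \<Longrightarrow> Q1 c v \<noteq> 0 \<and> B' 1 \<noteq> 0"
          using Q1_Q2_common_zero[OF c, of v] z eval_pdiff_quartic_form[of _ v] inj
          by (auto simp: z_def A'_def B'_def)
        moreover have "z * D c v = Q1 c v - Q2 c v"
          using D_eq[of v c] by (simp add: z_def)
        moreover have "D c v * C' 1 = (A' 1 + B' 1) * y ^ 2"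
          using L eF1 two by auto
        moreover have "y ^ 4 * z ^ 2 - 2 * (Q1 c v + Q2 c v) * y ^ 2 + D c v ^ 2 = 0"
          using L eF by simp
        ultimately show False
          using no_other_singularity[OF False z two _ zC' _ _ Fy] by blast
      qed
      \<comment> \<open>At z = 0 both quartic forms reduce to \<open>x ^ 4\<close>.\<close>
      with Fy have "2 * x ^ 4 = 0"
        by (simp add: quartic_form_def z_def x_def)
      with two \<open>z = 0\<close> show ?thesis
        by (simp add: sing_cond_def x_def z_def)
    qed
  next
    assume R: "sing_cond c v"
    show "mpoly_eval (plane_sextic c) v = 0 \<and>
      (\<forall>i. mpoly_eval (pdiff i (plane_sextic c)) v = 0)"
    proof (cases "x = 0 \<and> z = 0")
      case True
      then have "Q1 c v = 0" "Q2 c v = 0" "D c v = 0"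
        by (auto simp: quartic_form_def cubic_form_def x_def z_def)
      moreover have "A' i = 0" "B' i = 0" for i
        using True by (simp_all add: A'_def B'_def x_def z_def quartic_form_def prod_4 pdiff_simps eval_simps)
      ultimately show ?thesis
        using True by (simp add: forall_3 eF eF1 eF2 eF3)
    next
      case False
      \<comment> \<open>Every term in F and in its three partial derivatives contains y or D as a
        factor.\<close>
      then have "y = 0" "D c v = 0"
        using R by (auto simp: sing_cond_def x_def y_def z_def)
      then show ?thesis
        by (simp add: forall_3 eF eF1 eF2 eF3)
    qed
  qed
qed

section \<open>Multiplicity of the singular points\<close>

lemma local_equation_plane_sextic:
  fixes v :: "'a::field ^ 3"
  defines "L i j \<equiv> if j = i then 1 else Var j + Const (v $ j / v $ i)"
  shows "local_equation (plane_sextic c) i v =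
    sextic_form (\<lambda>j. Const (c $ j)) (L i 1) (L i 2) (L i 3)"
  by (simp add: local_equation_def plane_sextic_def L_def Const.subst_sextic_form
      Const.subst_comp_Const Const.subst_Var)

lemma order_Var: "enat 1 \<le> mpoly_order (Var v :: (_, 'a::comm_ring_1) mpoly)"
  by (auto simp: le_mpoly_order_iff Var_def monom_degree_single)

text \<open>The upper bound comes from a substitution: an order above n would make the image
  divisible by \<open>a ^ Suc n\<close>.\<close>

lemma mpoly_order_eqI:
  fixes p :: "('v, 'a::comm_ring_1) mpoly"
  assumes "enat n \<le> mpoly_order p" "\<And>v. a dvd \<sigma> v" "\<not> a ^ Suc n dvd mpoly_subst h \<sigma> p"
  shows "mpoly_order p = enat n"
proof (rule antisym)
  show "mpoly_order p \<le> enat n"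
    using dvd_mpoly_subst_order[of "Suc n" p a \<sigma> h] assms(2,3)
    by (metis linorder_not_le Suc_ile_eq)
qed fact

lemma not_X_power_dvd:
  "coeff p n \<noteq> 0 \<Longrightarrow> \<not> [:0, 1::'a::comm_ring_1:] ^ Suc n dvd p"
proof
  assume "coeff p n \<noteq> 0" "[:0, 1:] ^ Suc n dvd p"
  then obtain q where "p = [:0, 1:] ^ Suc n * q" by (elim dvdE)
  also have "[:0, 1:] ^ Suc n = monom (1::'a) (Suc n)"
    by (simp add: monom_altdef)
  finally show False using \<open>coeff p n \<noteq> 0\<close> by (simp add: coeff_monom_mult)
qed

text \<open>Each of the three terms has order at least 2 separately: two contain the square of y,
  and the last is the square of a polynomial vanishing at the origin.\<close>

lemma order_sextic_form:
  fixes p q :: "(3, 'a::comm_ring_1) mpoly"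
  assumes "enat 1 \<le> mpoly_order (cubic_form u p q)"
  shows "enat 2 \<le> mpoly_order (sextic_form u p (Var 2) q)"
proof -
  have V: "enat k \<le> mpoly_order (Var 2 ^ k :: (3, 'a) mpoly)" for k
    using le_mpoly_order_power[OF order_Var, of k "2 :: 3"] by simp
  have 1: "enat 4 \<le> mpoly_order (Var 2 ^ 4 * r)" for r :: "(3, 'a) mpoly"
    by (intro le_mpoly_order_multL V)
  have "enat 2 \<le> mpoly_order (Var 2 ^ 4 * r)" for r :: "(3, 'a) mpoly"
    by (rule order.trans[OF _ 1]) simp
  moreover have "enat 2 \<le> mpoly_order (r * Var 2 ^ 2)" for r :: "(3, 'a) mpoly"
    using le_mpoly_order_multL[OF V, of 2 r] by (simp add: mult.commute)
  moreover have "enat 2 \<le> mpoly_order (cubic_form u p q ^ 2)"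
    using le_mpoly_order_power[OF assms, of 2] by simp
  ultimately show ?thesis
    unfolding sextic_form_def by (intro le_mpoly_order_add le_mpoly_order_diff)
qed

lemma homogeneous_imp_le_order: "homogeneous n p \<Longrightarrow> enat n \<le> mpoly_order p"
  by (auto simp: homogeneous_def le_mpoly_order_iff)

lemma le_mpoly_order_mono: "enat n \<le> mpoly_order p \<Longrightarrow> k \<le> n \<Longrightarrow> enat k \<le> mpoly_order p"
  by (auto simp: le_mpoly_order_iff)

lemma quartic_form_const_poly:
  "quartic_form (\<lambda>i. [:a i:]) [:x:] [:z:] = [:quartic_form a x z:]"
  by (simp add: quartic_form_def prod_4 mult_ac)

lemma dcoeff_const_poly: "dcoeff k (\<lambda>i. [:u i:]) = [:dcoeff k u:]"
proof -
  have "(- 1) ^ k = [:(- 1 :: 'a) ^ k:]"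
    by (induction k) (auto simp: one_pCons)
  then show ?thesis by (simp add: dcoeff_def esym_def mult_ac)
qed

lemma cubic_form_const_poly:
  "cubic_form (\<lambda>i. [:u i:]) [:x:] [:z:] = [:cubic_form u x z:]"
  by (simp add: cubic_form_def dcoeff_const_poly poly_const_pow)

lemma quartic_form_scale: "quartic_form a (t * x) (t * z) = t ^ 4 * quartic_form a x z"
  by (simp add: quartic_form_def prod_4 algebra_simps power4_eq_xxxx)

lemma cubic_form_scale: "cubic_form u (t * x) (t * z) = t ^ 3 * cubic_form u x z"
  by (simp add: cubic_form_def algebra_simps power2_eq_square power3_eq_cube)

text \<open>In the chart y = 1 the quartic and cubic forms contribute only higher order, so the
  quadratic part is \<open>z ^ 2\<close>. The line x = 0 detects it.\<close>

lemma order_at_vertical_point: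
  fixes c :: "'a::idom ^ (4 + 4)"
  shows "mpoly_order (sextic_form (\<lambda>j. Const (c $ j)) (Var 1) 1 (Var 3 :: (3, 'a) mpoly)) = enat 2"
proof (rule mpoly_order_eqI)
  let ?u = "\<lambda>j. Const (c $ j) :: (3, 'a) mpoly"
  have "enat 2 \<le> mpoly_order (Var 3 ^ 2 :: (3, 'a) mpoly)"
    using le_mpoly_order_power[OF order_Var, of 2 "3 :: 3"] by simp
  moreover have "enat 2 \<le> mpoly_order (quartic_form (\<lambda>j. Const (b j)) (Var 1) (Var 3 :: (3, 'a) mpoly))" for b
    by (rule le_mpoly_order_mono[OF homogeneous_imp_le_order[OF homogeneous_quartic_form]]) simp
  moreover have "enat 2 \<le> mpoly_order (cubic_form ?u (Var 1) (Var 3))"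
    by (rule le_mpoly_order_mono[OF homogeneous_imp_le_order[OF homogeneous_cubic_form]]) simp
  moreover define A B C where "A = quartic_form (\<lambda>j. Const (c $ Inl j)) (Var 1) (Var (3 :: 3))"
    and "B = quartic_form (\<lambda>j. Const (c $ Inr j)) (Var 1) (Var (3 :: 3))"
    and "C = cubic_form ?u (Var 1) (Var 3)"
  ultimately have "enat 2 \<le> mpoly_order (Var 3 ^ 2 - ((A + B) + (A + B)) + C * C)"
    by (intro le_mpoly_order_add le_mpoly_order_diff le_mpoly_order_multL) simp_all
  also have "Var 3 ^ 2 - ((A + B) + (A + B)) + C * C = sextic_form ?u (Var 1) 1 (Var 3)"
    by (simp add: sextic_form_def comp_def A_def B_def C_def power2_eq_square)
  finally show "enat 2 \<le> mpoly_order (sextic_form ?u (Var 1) 1 (Var 3))" .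
  show "[:0, 1:] dvd (if v = (3::3) then [:0, 1:] else 0 :: 'a poly)" for v
    by simp
  have "coeff (sextic_form (\<lambda>j. [:c $ j:]) 0 1 [:0, 1:]) 2 \<noteq> 0"
    by (simp add: sextic_form_def comp_def quartic_form_def prod_4 cubic_form_def dcoeff_const_poly
        numeral_poly numeral_eq_Suc)
  then show "\<not> [:0, 1:] ^ Suc 2 dvd mpoly_subst (\<lambda>a. [:a:])
      (\<lambda>v. if v = 3 then [:0, 1:] else 0) (sextic_form ?u (Var 1) 1 (Var 3))"
    by (simp only: pCons.subst_sextic_form pCons.subst_comp_Const pCons.subst_simps)
      (rule not_X_power_dvd, simp)
qed

text \<open>The alternatives for \<open>p\<close> and \<open>q\<close> cover the charts x \<noteq> 0
  and z \<noteq> 0 together; \<open>x\<close> and \<open>z\<close> are the values of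
  \<open>p\<close> and \<open>q\<close> at the origin.\<close>

lemma order_on_axis:
  fixes c :: "'a::idom ^ (4 + 4)" and p q :: "(3, 'a) mpoly"
  assumes two: "(2::'a) \<noteq> 0"
    and p: "p = Var 1 + Const x \<or> p = 1 \<and> x = 1"
    and q: "q = Var 3 + Const z \<or> q = 1 \<and> z = 1"
    and C: "cubic_form (($) c) x z = 0"
    and Q: "quartic_form (\<lambda>i. c $ Inl i) x z + quartic_form (\<lambda>i. c $ Inr i) x z \<noteq> 0"
  shows "mpoly_order (sextic_form (\<lambda>j. Const (c $ j)) p (Var 2) q) = enat 2"
proof (rule mpoly_order_eqI)
  let ?u = "\<lambda>j. Const (c $ j) :: (3, 'a) mpoly"
  have "mpoly_subst (\<lambda>a. a) (\<lambda>_. 0) p = x" "mpoly_subst (\<lambda>a. a) (\<lambda>_. 0) q = z"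
    using p q by (auto simp: ident.subst_simps)
  then show "enat 2 \<le> mpoly_order (sextic_form ?u p (Var 2) q)"
    using C by (intro order_sextic_form)
      (simp only: one_le_mpoly_order_iff ident.subst_cubic_form ident.subst_comp_Const)
  \<comment> \<open>Only y varies along this line. There D is the constant 0 and the first term of F
    has degree at least 4 in y, so the coefficient of \<open>y ^ 2\<close> is read off from the
    middle term.\<close>
  let ?\<sigma> = "\<lambda>v. if v = (2::3) then [:0, 1:] else 0 :: 'a poly"
  show "[:0, 1:] dvd ?\<sigma> v" for v
    by simp
  have pq: "mpoly_subst (\<lambda>a. [:a:]) ?\<sigma> p = [:x:]" "mpoly_subst (\<lambda>a. [:a:]) ?\<sigma> q = [:z:]"
    using p q by (auto simp: pCons.subst_simps one_pCons)
  have "coeff (sextic_form (\<lambda>j. [:c $ j:]) [:x:] [:0, 1:] [:z:]) 2 =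
     - 2 * (quartic_form (\<lambda>i. c $ Inl i) x z + quartic_form (\<lambda>i. c $ Inr i) x z)"
    by (simp add: sextic_form_def comp_def quartic_form_const_poly cubic_form_const_poly C
        numeral_poly numeral_eq_Suc)
  also have "\<dots> \<noteq> 0"
    using two Q by (simp only: mult_eq_0_iff neg_equal_0_iff_equal simp_thms)
  finally show "\<not> [:0, 1:] ^ Suc 2 dvd mpoly_subst (\<lambda>a. [:a:]) ?\<sigma> (sextic_form ?u p (Var 2) q)"
    by (simp only: pCons.subst_sextic_form pCons.subst_comp_Const pq pCons.subst_Var if_True simp_thms)
      (rule not_X_power_dvd)
qed

lemma multiplicity_2:
  fixes c :: "'a::field ^ (4 + 4)" and v :: "'a ^ 3"
  assumes two: "(2::'a) \<noteq> 0" and c: "c \<in> distinct_tuples"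
    and v: "sing_cond c v" "v $ i \<noteq> 0"
  shows "mpoly_order (local_equation (plane_sextic c) i v) = enat 2"
proof (cases "v $ 1 = 0 \<and> v $ 3 = 0")
  case True
  then have "i = 2" using v(2) exhaust_3[of i] by auto
  then show ?thesis
    using True by (simp add: local_equation_plane_sextic Const_0 order_at_vertical_point)
next
  case False
  then have v2: "v $ 2 = 0" "D c v = 0"
    using v(1) by (auto simp: sing_cond_def)
  then have i: "i = 1 \<or> i = 3"
    using v(2) exhaust_3[of i] by auto
  have sc: "cubic_form (($) c) (v $ 1 / v $ i) (v $ 3 / v $ i) = 0"
    using cubic_form_scale[of "($) c" "1 / v $ i" "v $ 1" "v $ 3"] v2 by simp
  \<comment> \<open>Where D vanishes the two quartics agree, so a vanishing sum would produce a
    common zero.\<close>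
  have "Q1 c v + Q2 c v \<noteq> 0"
  proof
    assume "Q1 c v + Q2 c v = 0"
    moreover have "Q1 c v = Q2 c v" using D_eq[of v c] v2 by simp
    ultimately have "2 * Q1 c v = 0" by simp
    then have "Q1 c v = 0" using two by (simp only: mult_eq_0_iff simp_thms)
    then show False using \<open>Q1 c v = Q2 c v\<close> Q1_Q2_common_zero[OF c] False by metis
  qed
  then have Q: "quartic_form (\<lambda>j. c $ Inl j) (v $ 1 / v $ i) (v $ 3 / v $ i) +
      quartic_form (\<lambda>j. c $ Inr j) (v $ 1 / v $ i) (v $ 3 / v $ i) \<noteq> 0"
    using quartic_form_scale[of _ "1 / v $ i" "v $ 1" "v $ 3"] v(2)
    by (simp flip: distrib_left add_divide_distrib)
  have "mpoly_order (sextic_form (\<lambda>j. Const (c $ j))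
      (if 1 = i then 1 else Var 1 + Const (v $ 1 / v $ i)) (Var 2)
      (if 3 = i then 1 else Var 3 + Const (v $ 3 / v $ i)) :: (3, 'a) mpoly) = enat 2"
    using v(2) by (intro order_on_axis[OF two _ _ sc Q]) auto
  then show ?thesis
    using i v2 by (auto simp: local_equation_plane_sextic Const_0)
qed

section \<open>Counting the singular points\<close>

text \<open>The point (x : y : z) in coordinates. For x = y = z = 0 the set is \<open>{0}\<close>,
  which is not a point of the plane.\<close>

definition pt :: "'a::field \<Rightarrow> 'a \<Rightarrow> 'a \<Rightarrow> ('a ^ 3) set" where
  "pt x y z = {v. \<exists>t. t \<noteq> 0 \<and> v $ 1 = t * x \<and> v $ 2 = t * y \<and> v $ 3 = t * z}"

definition vec3 :: "'a \<Rightarrow> 'a \<Rightarrow> 'a \<Rightarrow> 'a ^ 3" where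
  "vec3 x y z = (\<chi> i. if i = 1 then x else if i = 2 then y else z)"

lemma vec3_nth [simp]: "vec3 x y z $ 1 = x" "vec3 x y z $ 2 = y" "vec3 x y z $ 3 = z"
  by (simp_all add: vec3_def)

lemma vec3_in_pt: "vec3 x y z \<in> pt x y z"
  unfolding pt_def by (intro CollectI exI[of _ 1]) simp

lemma vec3_eq_0_iff: "(v :: 'a::zero ^ 3) = 0 \<longleftrightarrow> v $ 1 = 0 \<and> v $ 2 = 0 \<and> v $ 3 = 0"
  by (simp add: vec_eq_iff forall_3)

lemma proj_rel_image: "v \<noteq> 0 \<Longrightarrow> proj_rel `` {v} = pt (v $ 1) (v $ 2) (v $ 3)"
  by (auto simp: proj_rel_def pt_def vec_eq_iff forall_3)

lemma proj_plane_eq: "proj_plane = {pt x y z |x y z. x \<noteq> 0 \<or> y \<noteq> 0 \<or> z \<noteq> 0}"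
proof (intro equalityI subsetI)
  fix P :: "('a ^ 3) set" assume "P \<in> proj_plane"
  then obtain v where "v \<noteq> 0" "P = proj_rel `` {v}"
    by (auto simp: proj_plane_def elim: quotientE)
  then show "P \<in> {pt x y z |x y z. x \<noteq> 0 \<or> y \<noteq> 0 \<or> z \<noteq> 0}"
    using proj_rel_image[of v] by (auto simp: vec3_eq_0_iff)
next
  fix P :: "('a ^ 3) set" assume "P \<in> {pt x y z |x y z. x \<noteq> 0 \<or> y \<noteq> 0 \<or> z \<noteq> 0}"
  then obtain x y z where P: "P = pt x y z" "x \<noteq> 0 \<or> y \<noteq> 0 \<or> z \<noteq> 0" by blast
  have "vec3 x y z \<noteq> 0" using P(2) by (simp add: vec3_eq_0_iff)
  then show "P \<in> proj_plane"
    using P(1) proj_rel_image[of "vec3 x y z"] quotientI[of "vec3 x y z" "UNIV - {0}" proj_rel]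
    by (simp add: proj_plane_def)
qed

lemma pt_in_proj_plane: "x \<noteq> 0 \<or> y \<noteq> 0 \<or> z \<noteq> 0 \<Longrightarrow> pt x y z \<in> proj_plane"
  unfolding proj_plane_eq by blast

lemma pt_scale: "t \<noteq> 0 \<Longrightarrow> pt (t * x) (t * y) (t * z) = pt x y z"
proof (intro equalityI subsetI)
  fix v assume "t \<noteq> 0" "v \<in> pt x y z"
  then obtain s where "s \<noteq> 0" "v $ 1 = s * x" "v $ 2 = s * y" "v $ 3 = s * z"
    by (auto simp: pt_def)
  with \<open>t \<noteq> 0\<close> show "v \<in> pt (t * x) (t * y) (t * z)"
    by (auto simp: pt_def intro!: exI[of _ "s / t"])
next
  fix v assume "t \<noteq> 0" "v \<in> pt (t * x) (t * y) (t * z)"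
  then obtain s where "s \<noteq> 0" "v $ 1 = s * (t * x)" "v $ 2 = s * (t * y)" "v $ 3 = s * (t * z)"
    by (auto simp: pt_def)
  with \<open>t \<noteq> 0\<close> show "v \<in> pt x y z"
    by (auto simp: pt_def mult.assoc intro!: exI[of _ "s * t"])
qed

lemma pt_eqD:
  assumes "pt x y z = pt x' y' z'"
  shows "\<exists>t. t \<noteq> 0 \<and> x = t * x' \<and> y = t * y' \<and> z = t * z'"
proof -
  have "vec3 x y z \<in> pt x' y' z'" using vec3_in_pt[of x y z] assms by simp
  then show ?thesis by (simp add: pt_def)
qed

text \<open>The form D at z = 1. On the axis y = 0 its roots give the singular points with z
  \<noteq> 0, and vanishing of \<open>dcoeff 3\<close> gives the one at infinity.\<close>

definition cubic_poly :: "'a::comm_ring_1 ^ (4 + 4) \<Rightarrow> 'a poly" where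
  "cubic_poly c = [:dcoeff 0 (($) c), dcoeff 1 (($) c), dcoeff 2 (($) c), dcoeff 3 (($) c):]"

lemma poly_cubic_poly: "poly (cubic_poly c) x = cubic_form (($) c) x 1"
  by (simp add: cubic_poly_def cubic_form_def algebra_simps power2_eq_square power3_eq_cube)

lemma singular_points_eq:
  fixes c :: "'a::field ^ (4 + 4)"
  assumes two: "(2::'a) \<noteq> 0" and c: "c \<in> distinct_tuples"
  shows "singular_points (plane_sextic c) = insert (pt 0 1 0)
    ((\<lambda>r. pt r 0 1) ` {r. poly (cubic_poly c) r = 0} \<union>
     (if dcoeff 3 (($) c) = 0 then {pt 1 0 0} else {}))" (is "_ = ?S")
proof -
  have sing: "singular_points (plane_sextic c) = {P \<in> proj_plane. \<forall>v\<in>P. sing_cond c v}"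
    using singular_iff[OF two c] by (auto simp: singular_points_def zero_locus_def)
  \<comment> \<open>D is homogeneous, so the condition may be tested on any one
    representative.\<close>
  have sc: "(\<forall>v\<in>pt x y z. sing_cond c v) \<longleftrightarrow>
      x = 0 \<and> z = 0 \<or> y = 0 \<and> cubic_form (($) c) x z = 0" for x y z
  proof -
    have "pt x y z \<noteq> {}" using vec3_in_pt by blast
    moreover have "sing_cond c v \<longleftrightarrow> x = 0 \<and> z = 0 \<or> y = 0 \<and> cubic_form (($) c) x z = 0"
      if "v \<in> pt x y z" for v
      using that by (auto simp: pt_def sing_cond_def cubic_form_scale)
    ultimately show ?thesis by blast
  qed
  show ?thesis
  proof (intro equalityI subsetI)
    fix P assume "P \<in> singular_points (plane_sextic c)"
    then obtain x y z where P: "P = pt x y z" and n: "x \<noteq> 0 \<or> y \<noteq> 0 \<or> z \<noteq> 0"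
      and s: "x = 0 \<and> z = 0 \<or> y = 0 \<and> cubic_form (($) c) x z = 0"
      unfolding sing proj_plane_eq by (auto simp: sc)
    show "P \<in> ?S"
    proof (cases "x = 0 \<and> z = 0")
      case True
      then show ?thesis using n P pt_scale[of y 0 1 0] by auto
    next
      case False
      then have y: "y = 0" and C: "cubic_form (($) c) x z = 0" using s by auto
      show ?thesis
      proof (cases "z = 0")
        case True
        then have "x \<noteq> 0" using False by simp
        then have "dcoeff 3 (($) c) = 0"
          using C True by (simp add: cubic_form_def)
        moreover have "P = pt 1 0 0"
          using pt_scale[of x 1 0 0] \<open>x \<noteq> 0\<close> P y True by simp
        ultimately show ?thesis by simp
      next
        case False
        then have "P = pt (x / z) 0 1"
          using pt_scale[of z "x / z" 0 1] P y by simp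
        moreover have "poly (cubic_poly c) (x / z) = 0"
          using cubic_form_scale[of "($) c" z "x / z" 1] C False by (simp add: poly_cubic_poly)
        ultimately show ?thesis by blast
      qed
    qed
  next
    fix P assume "P \<in> ?S"
    then consider "P = pt 0 1 0" | r where "P = pt r 0 1" "poly (cubic_poly c) r = 0"
      | "P = pt 1 0 0" "dcoeff 3 (($) c) = 0"
      by (auto split: if_splits)
    then show "P \<in> singular_points (plane_sextic c)"
    proof cases
      case 1
      then show ?thesis using sc[of 0 1 0] by (simp add: sing pt_in_proj_plane)
    next
      case 2
      then show ?thesis using sc[of r 0 1] by (simp add: sing pt_in_proj_plane poly_cubic_poly)
    next
      case 3
      then have "cubic_form (($) c) 1 0 = 0" by (simp add: cubic_form_def)
      then show ?thesis using 3 sc[of 1 0 0] by (simp add: sing pt_in_proj_plane)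
    qed
  qed
qed

text \<open>If D vanished identically at z = 1, then \<phi>1 and \<phi>2 would agree and share the
  root \<open>c $ Inl 1\<close>.\<close>

lemma cubic_poly_nonzero:
  fixes c :: "'a::field ^ (4 + 4)"
  assumes "c \<in> distinct_tuples"
  shows "cubic_poly c \<noteq> 0"
proof
  assume "cubic_poly c = 0"
  define v where "v = vec3 (c $ Inl 1) 1 1"
  have "Q1 c v = 0" by (auto simp: v_def quartic_form_eq_0_iff)
  moreover have "D c v = 0"
    using poly_cubic_poly[of c "c $ Inl 1"] \<open>cubic_poly c = 0\<close> by (simp add: v_def)
  ultimately have "Q2 c v = 0" using D_eq[of v c] by simp
  then show False
    using Q1_Q2_common_zero[OF assms \<open>Q1 c v = 0\<close>] by (simp add: v_def)
qed

lemma card_singular_points: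
  fixes c :: "'a::field ^ (4 + 4)"
  assumes two: "(2::'a) \<noteq> 0" and c: "c \<in> distinct_tuples"
  shows "card (singular_points (plane_sextic c)) =
    1 + card {r. poly (cubic_poly c) r = 0} + (if dcoeff 3 (($) c) = 0 then 1 else 0)"
proof -
  let ?R = "{r. poly (cubic_poly c) r = 0}" and ?f = "\<lambda>r. pt r (0::'a) 1"
  have fin: "finite ?R" using poly_roots_finite[OF cubic_poly_nonzero[OF c]] .
  have inj: "inj ?f" by (auto simp: inj_def dest: pt_eqD)
  have "pt 0 1 0 \<noteq> pt 1 0 (0::'a)" "\<And>r. pt 0 1 0 \<noteq> ?f r" "\<And>r. pt 1 0 0 \<noteq> ?f r"
    by (auto dest: pt_eqD)
  then show ?thesis
    using fin card_image[OF inj_on_subset[OF inj subset_UNIV], of ?R]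
    by (auto simp: singular_points_eq[OF two c] image_iff)
qed

text \<open>If \<open>dcoeff 3\<close> is zero, at most two affine roots join (1 : 0 : 0) and (0 : 1
  : 0). Otherwise D has degree 3, and algebraic closedness gives at least one root beside (0 : 1 :
  0).\<close>

lemma card_singular_points_bounds:
  fixes c :: "'a::alg_closed_field ^ (4 + 4)"
  assumes two: "(2::'a) \<noteq> 0" and c: "c \<in> distinct_tuples"
  shows "card (singular_points (plane_sextic c)) \<in> {2, 3, 4}"
proof -
  let ?p = "cubic_poly c" and ?R = "{r. poly (cubic_poly c) r = 0}"
  have p: "?p \<noteq> 0" by (rule cubic_poly_nonzero[OF c])
  have "card ?R \<le> degree ?p" by (rule card_poly_roots_bound[OF p])
  show ?thesis
  proof (cases "dcoeff 3 (($) c) = 0")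
    case True
    then have "degree ?p \<le> 2" by (simp add: cubic_poly_def)
    with \<open>card ?R \<le> degree ?p\<close> have "card ?R \<in> {0, 1, 2}" by auto
    then show ?thesis using True by (auto simp: card_singular_points[OF two c])
  next
    case False
    then have deg: "degree ?p = 3" by (simp add: cubic_poly_def)
    then have "?R \<noteq> {}" using alg_closed_imp_poly_has_root[of ?p] by auto
    then have "card ?R \<noteq> 0" using poly_roots_finite[OF p] by simp
    with \<open>card ?R \<le> degree ?p\<close> deg have "card ?R \<in> {1, 2, 3}" by auto
    then show ?thesis using False by (auto simp: card_singular_points[OF two c])
  qed
qed

section \<open>Generic tuples\<close>

text \<open>The discriminant of the cubic \<open>a * x ^ 3 + b * x ^ 2 + c * x + d\<close>.\<close>

definition disc :: "'a::comm_ring_1 \<Rightarrow> 'a \<Rightarrow> 'a \<Rightarrow> 'a \<Rightarrow> 'a" where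
  "disc a b c d = b ^ 2 * c ^ 2 - 4 * a * c ^ 3 - 4 * b ^ 3 * d - 27 * a ^ 2 * d ^ 2 + 18 * a * b * c * d"

lemma disc_scale: "disc (t * a) (t * b) (t * c) (t * d) = t ^ 4 * disc a b c d"
  by (simp add: disc_def algebra_simps power2_eq_square power3_eq_cube power4_eq_xxxx)

lemma disc_roots:
  "disc 1 (- (r + s + t)) (r * s + r * t + s * t) (- (r * s * t)) = ((r - s) * (r - t) * (s - t)) ^ 2"
  by (simp add: disc_def algebra_simps power2_eq_square power3_eq_cube power4_eq_xxxx)

text \<open>Over an algebraically closed field the cubic splits, and the discriminant becomes
  \<open>a ^ 4\<close> times the squared product of root differences.\<close>

lemma card_roots_cubic:
  fixes a b c d :: "'a::alg_closed_field"
  assumes "a \<noteq> 0" "disc a b c d \<noteq> 0"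
  shows "card {x. poly [:d, c, b, a:] x = 0} = 3"
proof -
  let ?p = "[:d, c, b, a:]"
  have p: "?p \<noteq> 0" "degree ?p = 3" "lead_coeff ?p = a"
    using assms(1) by auto
  then obtain A where A: "size A = 3" "?p = smult a (\<Prod>x\<in>#A. [:-x, 1:])"
    using alg_closed_imp_factorization[of ?p] by metis
  obtain r B where B: "A = add_mset r B" "size B = 2"
    using size_eq_Suc_imp_eq_union[of A 2] A(1) by auto
  obtain s C where C: "B = add_mset s C" "size C = 1"
    using size_eq_Suc_imp_eq_union[of B 1] B(2) by auto
  obtain t where "C = {#t#}"
    using size_1_singleton_mset[OF C(2)] by blast
  with B C have rst: "A = {#r, s, t#}" by simp
  have "(\<Prod>x\<in>#A. [:-x, 1:]) = [:-r, 1:] * [:-s, 1:] * [:-t, 1:]"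
    by (simp add: rst algebra_simps)
  with A(2) have f: "?p = smult a ([:-r, 1:] * [:-s, 1:] * [:-t, 1:])" by metis
  \<comment> \<open>Vieta's formulas, by comparison of coefficients.\<close>
  have "b = a * - (r + s + t)" "c = a * (r * s + r * t + s * t)" "d = a * - (r * s * t)"
    using f by (simp_all add: algebra_simps)
  then have "disc a b c d = a ^ 4 * ((r - s) * (r - t) * (s - t)) ^ 2"
    using disc_scale[of a 1 "- (r + s + t)"] by (simp only: disc_roots mult_1_right)
  then have "(r - s) * (r - t) * (s - t) \<noteq> 0"
    using assms(2) by auto
  then have "card {r, s, t} = 3" by auto
  moreover have "{x. poly ?p x = 0} = {r, s, t}"
    unfolding f poly_smult poly_mult using assms(1) by auto
  ultimately show ?thesis by simp
qed

text \<open>Over a finite field the product of all X - x, increased by 1, is nonconstant and takes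
  the value 1 everywhere.\<close>

lemma infinite_UNIV_alg_closed: "infinite (UNIV :: 'a::alg_closed_field set)"
proof
  assume fin: "finite (UNIV :: 'a set)"
  define p :: "'a poly" where "p = (\<Prod>x\<in>UNIV. [:- x, 1:])"
  have "degree p = card (UNIV :: 'a set)"
    unfolding p_def by (subst degree_prod_eq_sum_degree) auto
  moreover have "card (UNIV :: 'a set) > 0" using fin by (simp add: card_gt_0_iff)
  ultimately have "degree (p + 1) > 0"
    by (subst degree_add_eq_left) auto
  then obtain x where "poly (p + 1) x = 0" using alg_closed_imp_poly_has_root by blast
  moreover have "poly p x = 0" using fin by (simp add: p_def poly_prod)
  ultimately show False by simp
qed

text \<open>For the choice \<open>\<beta>\<^sub>i = - \<alpha>\<^sub>i\<close> the difference \<open>\<phi>\<^sub>1 - \<phi>\<^sub>2\<close> is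
  \<open>- 2 (e\<^sub>1 x\<^sup>3 + e\<^sub>3 x)\<close>, which has distinct roots if \<open>e\<^sub>1, e\<^sub>3 \<noteq> 0\<close>.\<close>

lemma exists_generic_tuple:
  assumes two: "(2::'a::alg_closed_field) \<noteq> 0"
  shows "\<exists>c :: 'a ^ (4 + 4). c \<in> distinct_tuples \<and> dcoeff 3 (($) c) \<noteq> 0 \<and>
    disc (dcoeff 3 (($) c)) (dcoeff 2 (($) c)) (dcoeff 1 (($) c)) (dcoeff 0 (($) c)) \<noteq> 0"
proof -
  have ex: "\<exists>x::'a. x \<notin> S" if "finite S" for S
    using that infinite_UNIV_alg_closed ex_new_if_finite by blast
  \<comment> \<open>Avoiding zero and the earlier values up to sign makes the eight entries
    distinct. The extra value excluded for \<open>r\<close> keeps p q + p r + q r nonzero; those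
    excluded for \<open>s\<close> keep the elementary symmetric functions e1 and e3 of all four
    values nonzero.\<close>
  obtain p :: 'a where p: "p \<notin> {0}"
    using ex[of "{0}"] by auto
  obtain q where q: "q \<notin> {0, p, - p}"
    using ex[of "{0, p, - p}"] by auto
  obtain r where r: "r \<notin> {0, p, - p, q, - q, - (p * q) / (p + q)}"
    using ex[of "{0, p, - p, q, - q, - (p * q) / (p + q)}"] by auto
  obtain s where s: "s \<notin> {0, p, - p, q, - q, r, - r, - (p + q + r), - (p * q * r) / (p * q + p * r + q * r)}"
    using ex[of "{0, p, - p, q, - q, r, - r, - (p + q + r), - (p * q * r) / (p * q + p * r + q * r)}"] by auto
  define \<alpha> :: "4 \<Rightarrow> 'a" where "\<alpha> i = (if i = 1 then p else if i = 2 then q else if i = 3 then r else s)" for i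
  define c :: "'a ^ (4 + 4)" where "c = (\<chi> i. case i of Inl j \<Rightarrow> \<alpha> j | Inr j \<Rightarrow> - \<alpha> j)"
  have \<alpha>: "\<alpha> 1 = p" "\<alpha> 2 = q" "\<alpha> 3 = r" "\<alpha> 4 = s" by (simp_all add: \<alpha>_def)
  have cc: "c $ Inl j = \<alpha> j" "c $ Inr j = - \<alpha> j" for j by (simp_all add: c_def)
  have neg: "x \<noteq> - x" if "x \<noteq> 0" for x :: 'a
  proof
    assume "x = - x"
    then have "2 * x = 0" by (metis add.right_inverse mult_2)
    then show False using two that by (simp only: mult_eq_0_iff simp_thms)
  qed
  have a: "i = j" if "\<alpha> i = \<alpha> j" for i j
    using exhaust_4[of i] exhaust_4[of j] that p q r s by (auto simp: \<alpha>)
  have n1: "q \<noteq> - p" "r \<noteq> - p" "r \<noteq> - q" "s \<noteq> - p" "s \<noteq> - q" "s \<noteq> - r"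
    using q r s by simp_all
  have n2: "p \<noteq> - q" "p \<noteq> - r" "q \<noteq> - r" "p \<noteq> - s" "q \<noteq> - s" "r \<noteq> - s"
    using n1 by (metis minus_minus)+
  have n3: "p \<noteq> - p" "q \<noteq> - q" "r \<noteq> - r" "s \<noteq> - s"
    using p q r s neg by blast+
  have b: "\<alpha> i \<noteq> - \<alpha> j" for i j
    using exhaust_4[of i] exhaust_4[of j] n1 n2 n3 by (elim disjE) (simp_all add: \<alpha>)
  have "c \<in> distinct_tuples"
    unfolding distinct_tuples_def inj_def
  proof (intro CollectI allI impI)
    fix x y assume "c $ x = c $ y"
    then show "x = y"
      using a b b[THEN not_sym] by (cases x; cases y) (auto simp: cc)
  qed
  \<comment> \<open>A change of sign of all four roots preserves e2 and e4 and negates e1 and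
    e3.\<close>
  have d: "dcoeff 3 (($) c) = - (2 * (p + q + r + s))"
    "dcoeff 1 (($) c) = - (2 * (p * q * r + p * q * s + p * r * s + q * r * s))"
    "dcoeff 2 (($) c) = 0" "dcoeff 0 (($) c) = 0"
    by (simp_all add: dcoeff_def esym_def cc \<alpha> algebra_simps)
  have "s \<noteq> - (p + q + r)" using s by blast
  then have e1: "p + q + r + s \<noteq> 0" by (metis add.commute eq_neg_iff_add_eq_0)
  have pq: "p + q \<noteq> 0" using n1(1) by (metis add.commute eq_neg_iff_add_eq_0)
  have e2: "p * q + p * r + q * r \<noteq> 0"
  proof
    assume "p * q + p * r + q * r = 0"
    then have "r * (p + q) = - (p * q)"
      by (simp add: eq_neg_iff_add_eq_0 algebra_simps)
    then have "r = - (p * q) / (p + q)" by (simp only: nonzero_eq_divide_eq[OF pq])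
    then show False using r by blast
  qed
  have e3: "p * q * r + p * q * s + p * r * s + q * r * s \<noteq> 0"
  proof
    assume "p * q * r + p * q * s + p * r * s + q * r * s = 0"
    then have "s * (p * q + p * r + q * r) = - (p * q * r)"
      by (simp add: eq_neg_iff_add_eq_0 algebra_simps)
    then have "s = - (p * q * r) / (p * q + p * r + q * r)" by (simp only: nonzero_eq_divide_eq[OF e2])
    then show False using s by blast
  qed
  \<comment> \<open>For b = d = 0 the discriminant is \<open>- 4 * a * c ^ 3\<close>, so it remains
    to see that 4 and both remaining coefficients are nonzero.\<close>
  have "(2::'a) * 2 \<noteq> 0" using two by (simp only: mult_eq_0_iff simp_thms)
  then have four: "(4::'a) \<noteq> 0" by simp
  have "dcoeff 3 (($) c) \<noteq> 0" "dcoeff 1 (($) c) \<noteq> 0"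
    unfolding d using two e1 e3 by (simp_all only: mult_eq_0_iff neg_equal_0_iff_equal simp_thms)
  with \<open>c \<in> distinct_tuples\<close> four show ?thesis
    by (intro exI[of _ c]) (simp add: d(3,4) disc_def)
qed

text \<open>Applied to the indeterminates, \<open>dcoeff\<close> is itself a polynomial on the space
  of 8-tuples. This makes the genericity condition a polynomial one.\<close>

lemma eval_dcoeff: "mpoly_eval (dcoeff k Var) c = dcoeff k (($) c)"
  by (simp add: mpoly_eval_def ident.subst_dcoeff comp_def ident.subst_Var)

lemma eval_disc: "mpoly_eval (disc p q r s) v =
    disc (mpoly_eval p v) (mpoly_eval q v) (mpoly_eval r v) (mpoly_eval s v)"
  by (simp add: disc_def eval_simps)

theorem theorem2:
  assumes "CHAR('k::alg_closed_field) = 0 \<or> CHAR('k) \<ge> 5"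
  shows "(\<forall>c \<in> (distinct_tuples :: ('k ^ (4 + 4)) set).
            card (singular_points (homogenize (howe_sextic c))) \<in> {2, 3, 4} \<and>
            (\<forall>P \<in> singular_points (homogenize (howe_sextic c)).
               has_multiplicity (homogenize (howe_sextic c)) P 2)) \<and>
         (\<exists>U. zariski_open_in (distinct_tuples :: ('k ^ (4 + 4)) set) U \<and> U \<noteq> {} \<and>
            (\<forall>c \<in> U. card (double_points (homogenize (howe_sextic c))) = 4))"
proof -
  \<comment> \<open>In characteristic 0 the claim says that 0 does not divide 2; otherwise the
    characteristic exceeds 2.\<close>
  have "\<not> CHAR('k) dvd 2"
  proof
    assume "CHAR('k) dvd 2"
    then show False using assms dvd_imp_le[of "CHAR('k)" 2] by auto
  qed
  then have two: "(2::'k) \<noteq> 0"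
    using of_nat_eq_0_iff_char_dvd[of 2, where ?'a = 'k] by simp
  have mult: "has_multiplicity (plane_sextic c) P 2"
    if "c \<in> distinct_tuples" "P \<in> singular_points (plane_sextic c)" for c :: "'k ^ (4 + 4)" and P
    unfolding has_multiplicity_def
  proof (intro ballI allI impI)
    fix v i assume v: "v \<in> P" "v $ i \<noteq> 0"
    have "sing_cond c v"
      using that(2) v(1) singular_iff[OF two that(1), of v]
      by (simp add: singular_points_def zero_locus_def)
    then show "mpoly_order (local_equation (plane_sextic c) i v) = enat 2"
      using multiplicity_2[OF two that(1)] v(2) by blast
  qed
  let ?d = "\<lambda>k. dcoeff k Var :: (4 + 4, 'k) mpoly"
  \<comment> \<open>Where \<open>g\<close> is nonzero, D has degree 3 with three distinct roots.
    Together with (0 : 1 : 0) they give exactly four singular points, all double.\<close>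
  define g where "g = ?d 3 * disc (?d 3) (?d 2) (?d 1) (?d 0)"
  define U where "U = distinct_tuples - {c. \<forall>p\<in>{g}. mpoly_eval p c = 0}"
  have g: "mpoly_eval g c = dcoeff 3 (($) c) *
      disc (dcoeff 3 (($) c)) (dcoeff 2 (($) c)) (dcoeff 1 (($) c)) (dcoeff 0 (($) c))" for c
    using eval_dcoeff[of _ c] eval_disc[of _ _ _ _ c]
    by (simp add: g_def mpoly_eval_def ident.subst_mult)
  have "card (double_points (plane_sextic c)) = 4" if "c \<in> U" for c
  proof -
    have c: "c \<in> distinct_tuples" using that by (simp add: U_def)
    have "double_points (plane_sextic c) = singular_points (plane_sextic c)"
      using mult[OF c] by (auto simp: double_points_def)
    moreover have "dcoeff 3 (($) c) \<noteq> 0" "card {r. poly (cubic_poly c) r = 0} = 3"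
      using that card_roots_cubic[of "dcoeff 3 (($) c)"] by (auto simp: U_def g cubic_poly_def)
    ultimately show ?thesis by (simp add: card_singular_points[OF two c])
  qed
  moreover have "U \<noteq> {}"
    using exists_generic_tuple[OF two] by (auto simp: U_def g)
  moreover have "zariski_open_in distinct_tuples U"
    unfolding zariski_open_in_def U_def by blast
  ultimately show ?thesis
    using card_singular_points_bounds[OF two] mult
    by (auto simp: homogenize_howe_sextic[OF two])
qed

end
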